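(* The dual $\left(K_5^{(3)}\right)^\star$ of $K_5^{(3)}$ is, up to isomorphism, the unique (not necessarily uniform) Šoltés' hypergraph of minimum size. That is, $\left(K_5^{(3)}\right)^\star$ is a Šoltés' hypergraph, every Šoltés' hypergraph has at least as many edges as $\left(K_5^{(3)}\right)^\star$, and every Šoltés' hypergraph with the same number of edges as $\left(K_5^{(3)}\right)^\star$ is isomorphic to it.
   Context: A hypergraph $H=(V,E)$ consists of a finite vertex set $V$ and a set $E\subseteq 2^V$ of (hyper)edges, each edge being a set of at least two vertices (edges of different sizes are allowed, and $E$ is a set, so there are no repeated edges). Its order is $|V|$ and its size is $|E|$. $K_n^{(r)}=\left([n],\binom{[n]}{r}\right)$ is the hypergraph on $[n]=\{1,\ldots,n\}$ whose edges are all $r$-element subsets of $[n]$. The dual $H^\star$ of $H=(V,E)$ is the hypergraph whose vertices are the edges of $H$ and whose edges are the sets $\{e\in E: x\in e\}$ for $x\in V$. For $v\in V$, $H\setminus v$ denotes the hypergraph with vertex set $V\setminus\{v\}$ whose edges are exactly the edges of $H$ that do not contain $v$. The distance $d(u,v)$ is the length $r$ of a shortest path $(v_0,e_1,v_1,\ldots,e_r,v_r)$ with $v_0=u$, $v_r=v$ and each $e_i$ an edge containing $v_{i-1}$ and $v_i$, no vertex or edge being repeated; it is infinite if there is no such path. $H$ is connected if all distances are finite. The total distance is $W(H)=\sum d(u,v)$, summed over all unordered pairs of distinct vertices. A Šoltés' hypergraph is a connected hypergraph $H$ such that $W(H\setminus v)$ is finite and $W(H)=W(H\setminus v)$ for every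 $v\in V$; by convention the one-vertex hypergraph $K_1$ is not a Šoltés' hypergraph, so a Šoltés' hypergraph has at least two vertices. *)

theory Defs
  imports Main "HOL-Library.Extended_Nat"
begin

record 'a hypergraph =
  verts :: "'a set"
  edges :: "'a set set"

definition hypergraph :: "'a hypergraph \<Rightarrow> bool" where
  "hypergraph H \<longleftrightarrow>
     finite (verts H) \<and> edges H \<subseteq> Pow (verts H) \<and> (\<forall>e\<in>edges H. 2 \<le> card e)"

definition hsize :: "'a hypergraph \<Rightarrow> nat" where
  "hsize H = card (edges H)"

definition complete_hypergraph :: "nat \<Rightarrow> nat \<Rightarrow> nat hypergraph" where
  "complete_hypergraph n r =
     \<lparr>verts = {1..n}, edges = {e. e \<subseteq> {1..n} \<and> card e = r}\<rparr>"

definition dual :: "'a hypergraph \<Rightarrow> 'a set hypergraph" where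
  "dual H = \<lparr>verts = edges H, edges = (\<lambda>x. {e \<in> edges H. x \<in> e}) ` verts H\<rparr>"

(* Deletion is strong: an edge through v is removed, not shrunk. *)
definition delete_vertex :: "'a hypergraph \<Rightarrow> 'a \<Rightarrow> 'a hypergraph" where
  "delete_vertex H v = \<lparr>verts = verts H - {v}, edges = {e \<in> edges H. v \<notin> e}\<rparr>"

(* The path (v_0, e_1, v_1, ..., e_r, v_r) is given by vs = [v_0, ..., v_r] and
   es = [e_1, ..., e_r]; its length is r = length es. *)
definition hpath :: "'a hypergraph \<Rightarrow> 'a \<Rightarrow> 'a list \<Rightarrow> 'a set list \<Rightarrow> 'a \<Rightarrow> bool" where
  "hpath H u vs es v \<longleftrightarrow>
     length vs = Suc (length es) \<and> hd vs = u \<and> last vs = v \<and>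
     set vs \<subseteq> verts H \<and> set es \<subseteq> edges H \<and> distinct vs \<and> distinct es \<and>
     (\<forall>i < length es. vs ! i \<in> es ! i \<and> vs ! Suc i \<in> es ! i)"

(* Infinite if there is no path, since the infimum of the empty set is infinity in enat. *)
definition hdist :: "'a hypergraph \<Rightarrow> 'a \<Rightarrow> 'a \<Rightarrow> enat" where
  "hdist H u v = Inf {enat (length es) | vs es. hpath H u vs es v}"

definition hconnected :: "'a hypergraph \<Rightarrow> bool" where
  "hconnected H \<longleftrightarrow> (\<forall>u\<in>verts H. \<forall>v\<in>verts H. hdist H u v \<noteq> \<infinity>)"

(* Distance of the two elements of an unordered pair; well defined by pair_dist_eq below. *)
definition pair_dist :: "'a hypergraph \<Rightarrow> 'a set \<Rightarrow> enat" where
  "pair_dist H p = (THE d. \<exists>u v. p = {u, v} \<and> d = hdist H u v)"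

definition total_distance :: "'a hypergraph \<Rightarrow> enat" where
  "total_distance H = (\<Sum>p \<in> {p. p \<subseteq> verts H \<and> card p = 2}. pair_dist H p)"

definition soltes :: "'a hypergraph \<Rightarrow> bool" where
  "soltes H \<longleftrightarrow>
     hypergraph H \<and> 2 \<le> card (verts H) \<and> hconnected H \<and>
     (\<forall>v\<in>verts H. total_distance (delete_vertex H v) \<noteq> \<infinity> \<and>
                   total_distance H = total_distance (delete_vertex H v))"

definition hisomorphic :: "'a hypergraph \<Rightarrow> 'b hypergraph \<Rightarrow> bool" where
  "hisomorphic G H \<longleftrightarrow>
     (\<exists>f. bij_betw f (verts G) (verts H) \<and> (\<lambda>e. f ` e) ` edges G = edges H)"

lemma hpath_rev:
  assumes "hpath H u vs es v"
  shows "hpath H v (rev vs) (rev es) u"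
proof -
  have len: "length vs = Suc (length es)" and "vs \<noteq> []"
    using assms by (auto simp: hpath_def)
  have "rev vs ! i \<in> rev es ! i \<and> rev vs ! Suc i \<in> rev es ! i" if i: "i < length es" for i
  proof -
    let ?j = "length es - Suc i"
    have "vs ! ?j \<in> es ! ?j \<and> vs ! Suc ?j \<in> es ! ?j"
      using assms i by (simp add: hpath_def)
    moreover have "Suc ?j = length es - i" using i by simp
    ultimately show ?thesis using i len by (simp add: rev_nth)
  qed
  with assms \<open>vs \<noteq> []\<close> show ?thesis
    by (simp add: hpath_def hd_rev last_rev)
qed

lemma hdist_commute: "hdist H u v = hdist H v u"
proof -
  have "{enat (length es) | vs es. hpath H x vs es y}
      \<subseteq> {enat (length es) | vs es. hpath H y vs es x}" for x y
  proof
    fix d assume "d \<in> {enat (length es) | vs es. hpath H x vs es y}"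
    then obtain vs es where d: "d = enat (length (rev es))" and "hpath H x vs es y"
      by auto
    from hpath_rev[OF this(2)] d
    show "d \<in> {enat (length es) | vs es. hpath H y vs es x}" by blast
  qed
  then show ?thesis
    unfolding hdist_def by (intro arg_cong[where f = Inf] subset_antisym)
qed

lemma pair_dist_eq: "pair_dist H {u, v} = hdist H u v"
  unfolding pair_dist_def
  by (rule the_equality) (auto simp: doubleton_eq_iff hdist_commute)

end

theory Submission
  imports Defs
begin

text \<open>
  Describe each vertex \<open>v\<close> by its star, the set of edges through \<open>v\<close>; when the stars are distinct,
  they determine everything up to isomorphism. If the total distance survives every deletion, the
  stars form an antichain: if the star of \<open>u\<close> lies in that of \<open>v\<close>, then \<open>u\<close> is isolated once \<open>v\<close> is
  deleted (\<open>star_antichain\<close>). Every star has at least two edges, and every vertex avoids at least two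
  edges. With \<open>m\<close> edges this gives \<open>m \<ge> 4\<close>, and for \<open>m = 5\<close> all stars have two or three elements.

  The quantitative tool is \<open>deletion_inequality\<close>: the increments of the surviving distances must make
  up for the distances from the deleted vertex \<open>v\<close>, so their sum is at least the number of other
  vertices, plus the number of vertices that share no edge with \<open>v\<close>. If exactly two edges \<open>d\<close> and
  \<open>e\<close> avoid \<open>v\<close>, the only distances that can grow are those between \<open>P = d - e\<close> and \<open>Q = e - d\<close>,
  from one to two, so that \<open>|P| + |Q| + |d \<inter> e| \<le> |P| |Q|\<close>. Four edges are impossible because then
  \<open>|P|, |Q| \<le> 2\<close>.

  Let there be five edges and a star \<open>{a, b, c}\<close>. Removing \<open>d\<close> from the stars of \<open>P\<close> and \<open>e\<close> from
  those of \<open>Q\<close> gives two antichains of proper nonempty subsets of \<open>{a, b, c}\<close> that intersect each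
  other very often. This is possible only if both consist of doubletons (\<open>link_doubletons\<close>), whence
  \<open>|P|, |Q| \<le> 3\<close>, and the inequality leaves so little freedom that one triple forces all ten
  (\<open>triple_spreads\<close>, \<open>all_triples\<close>). A pair is then excluded by the antichain property.

  If all stars were pairs, the hypergraph would be the dual of a graph on five vertices. Let \<open>ab\<close> be
  an edge of this graph. Connectivity after the deletion shows that the three other vertices carry a
  path (\<open>pair_connects\<close>); the deletion inequality excludes a triangle and joins both ends of the path
  to \<open>a\<close> and \<open>b\<close> (\<open>pair_step\<close>). Applied to two of the edges found in this way, it gives a
  contradiction.

  So the stars are all ten triples of edges, which is the dual of the complete 3-uniform hypergraph on
  five points. That this dual has the required property is a count: all distances are one, the total
  is 45, and each deletion replaces nine distances by nine increments.
\<close>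

section \<open>Distances\<close>

text \<open>The sets \<open>star H v\<close> are the edges of the dual hypergraph.\<close>

definition star :: "'a hypergraph \<Rightarrow> 'a \<Rightarrow> 'a set set" where
  "star H v = {e \<in> edges H. v \<in> e}"

abbreviation pairs :: "'a set \<Rightarrow> 'a set set" where
  "pairs V \<equiv> {p. p \<subseteq> V \<and> card p = 2}"

lemma hdist_le: "hpath H u vs es v \<Longrightarrow> hdist H u v \<le> enat (length es)"
  unfolding hdist_def by (rule Inf_lower) blast

lemma hdist_ge:
  assumes "\<And>vs es. hpath H u vs es v \<Longrightarrow> k \<le> length es"
  shows "enat k \<le> hdist H u v"
  unfolding hdist_def by (rule Inf_greatest) (use assms in auto)

lemma hdist_ge_1:
  assumes "u \<noteq> v"
  shows "1 \<le> hdist H u v"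
proof -
  have "1 \<le> length es" if "hpath H u vs es v" for vs es
    using that assms by (cases es; cases vs) (auto simp: hpath_def)
  then have "enat 1 \<le> hdist H u v" by (rule hdist_ge)
  then show ?thesis by (simp add: one_enat_def)
qed

lemma hdist_ge_2:
  assumes "u \<noteq> v" and "star H u \<inter> star H v = {}"
  shows "2 \<le> hdist H u v"
proof -
  have "2 \<le> length es" if p: "hpath H u vs es v" for vs es
  proof (rule ccontr)
    assume "\<not> 2 \<le> length es"
    then consider "es = []" | e where "es = [e]"
      by (cases es rule: remdups_adj.cases) auto
    then show False
    proof cases
      case 1
      with p assms(1) show False by (cases vs) (auto simp: hpath_def)
    next
      case (2 e)
      with p obtain x y where "vs = [x, y]"
        by (auto simp: hpath_def length_Suc_conv)
      with p 2 have "e \<in> star H u \<inter> star H v"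
        by (auto simp: hpath_def star_def)
      with assms(2) show False by blast
    qed
  qed
  then have "enat 2 \<le> hdist H u v" by (rule hdist_ge)
  then show ?thesis by (simp add: numeral_eq_enat)
qed

lemma hdist_le_1:
  assumes "hypergraph H" "e \<in> edges H" "u \<in> e" "v \<in> e"
  shows "hdist H u v \<le> 1"
proof (cases "u = v")
  case True
  then have "hpath H u [u] [] v" using assms by (auto simp: hpath_def hypergraph_def)
  from hdist_le[OF this] show ?thesis by (simp add: zero_enat_def[symmetric])
next
  case False
  then have "hpath H u [u, v] [e] v" using assms by (auto simp: hpath_def hypergraph_def)
  from hdist_le[OF this] show ?thesis by (simp add: one_enat_def)
qed

lemma hdist_le_2:
  assumes H: "hypergraph H" and e: "e \<in> edges H" "f \<in> edges H"
    and i: "u \<in> e" "w \<in> e" "w \<in> f" "v \<in> f"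
  shows "hdist H u v \<le> 2"
proof (cases "(\<exists>g\<in>edges H. u \<in> g \<and> v \<in> g)")
  case True
  with hdist_le_1[OF H] have "hdist H u v \<le> 1" by blast
  then show ?thesis by (rule order_trans) (simp add: one_enat_def numeral_eq_enat)
next
  case False
  then have "hpath H u [u, w, v] [e, f] v"
    using assms by (auto simp: hpath_def hypergraph_def less_Suc_eq)
  from hdist_le[OF this] show ?thesis by (simp add: numeral_eq_enat eval_nat_numeral)
qed

lemma hdist_le_3:
  assumes H: "hypergraph H" and e: "e \<in> edges H" "f \<in> edges H" "g \<in> edges H"
    and i: "u \<in> e" "w \<in> e" "w \<in> f" "x \<in> f" "x \<in> g" "v \<in> g"
  shows "hdist H u v \<le> 3"
proof (cases "\<exists>h\<in>edges H. \<exists>k\<in>edges H. \<exists>y. u \<in> h \<and> y \<in> h \<and> y \<in> k \<and> v \<in> k")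
  case True
  with hdist_le_2[OF H] have "hdist H u v \<le> 2" by blast
  then show ?thesis by (rule order_trans) (simp add: numeral_eq_enat)
next
  case False
  with e i have ne: "u \<noteq> v" "u \<noteq> w" "u \<noteq> x" "w \<noteq> x" "w \<noteq> v" "x \<noteq> v" "e \<noteq> f" "f \<noteq> g" "e \<noteq> g"
    by metis+
  then have "hpath H u [u, w, x, v] [e, f, g] v"
    using assms by (auto simp: hpath_def hypergraph_def less_Suc_eq)
  from hdist_le[OF this] show ?thesis by (simp add: numeral_eq_enat eval_nat_numeral)
qed

text \<open>A set that no edge leaves is a union of components.\<close>

lemma hdist_infinite:
  assumes C: "\<And>e. e \<in> edges H \<Longrightarrow> e \<inter> C \<noteq> {} \<Longrightarrow> e \<subseteq> C"
    and u: "u \<in> C" and v: "v \<notin> C"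
  shows "hdist H u v = \<infinity>"
proof -
  have False if p: "hpath H u vs es v" for vs es
  proof -
    have "vs ! i \<in> C" if "i \<le> length es" for i
      using that
    proof (induction i)
      case 0
      with p u show ?case by (cases vs) (auto simp: hpath_def)
    next
      case (Suc i)
      then have "es ! i \<in> edges H" "vs ! i \<in> es ! i" "vs ! Suc i \<in> es ! i"
        using p by (auto simp: hpath_def)
      with Suc C[of "es ! i"] show ?case by auto
    qed
    from this[of "length es"] have "vs ! (length vs - 1) \<in> C" using p by (simp add: hpath_def)
    with p v show False by (cases "vs = []") (auto simp: hpath_def last_conv_nth)
  qed
  then have "{enat (length es) | vs es. hpath H u vs es v} = {}" by blast
  then show ?thesis by (simp add: hdist_def top_enat_def)
qed

section \<open>The deletion inequality\<close>

lemma delete_simps [simp]: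
  "verts (delete_vertex H v) = verts H - {v}"
  "edges (delete_vertex H v) = edges H - star H v"
  by (auto simp: delete_vertex_def star_def)

lemma hypergraph_delete: "hypergraph H \<Longrightarrow> hypergraph (delete_vertex H v)"
  by (auto simp: hypergraph_def star_def)

lemma pairs_E:
  assumes "p \<in> pairs V"
  obtains x y where "p = {x, y}" "x \<noteq> y" "x \<in> V" "y \<in> V"
  using assms by (auto simp: card_2_iff)

lemma finite_pairs: "finite V \<Longrightarrow> finite (pairs V)"
  by (rule finite_subset[of _ "Pow V"]) auto

lemma pairs_split:
  assumes "v \<in> V"
  shows "pairs V = pairs (V - {v}) \<union> (\<lambda>u. {v, u}) ` (V - {v})"
proof (intro equalityI subsetI)
  fix p assume "p \<in> pairs V"
  then obtain x y where "p = {x, y}" "x \<noteq> y" "x \<in> V" "y \<in> V" by (rule pairs_E)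
  then show "p \<in> pairs (V - {v}) \<union> (\<lambda>u. {v, u}) ` (V - {v})"
    by (cases "x = v"; cases "y = v") (auto simp: insert_commute)
qed (use assms in auto)

lemma sum_enat: "(\<Sum>x\<in>A. enat (f x)) = enat (\<Sum>x\<in>A. f x)"
  by (induction A rule: infinite_finite_induct) (auto simp: zero_enat_def)

lemma sum_one_plus_of_bool:
  assumes "finite A"
  shows "(\<Sum>x\<in>A. enat (1 + of_bool (P x))) = enat (card A + card {x \<in> A. P x})"
  unfolding sum_enat using assms
  by (subst sum.distrib) (simp add: of_bool_def sum.If_cases Int_def)

lemma sum_enat_finite:
  fixes f :: "'b \<Rightarrow> enat"
  assumes "finite A" "(\<Sum>x\<in>A. f x) \<noteq> \<infinity>" "x \<in> A"
  shows "f x \<noteq> \<infinity>"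
proof
  assume "f x = \<infinity>"
  with assms(1,3) have "sum f A = \<infinity>" by (simp add: sum.remove[of A x])
  with assms(2) show False by simp
qed

lemma enat_le_add:
  fixes a b c z :: enat
  assumes "a \<le> b" "b \<le> c" shows "a \<le> c + z"
proof -
  have "a \<le> c" using assms by (rule order_trans)
  also have "c \<le> c + z" by simp
  finally show ?thesis .
qed

lemma enat_le_add_1:
  fixes a b :: enat
  assumes "a \<le> 2" "1 \<le> b" shows "a \<le> b + enat 1"
proof -
  note assms(1)
  also have "(2 :: enat) = 1 + 1" by simp
  also have "\<dots> \<le> b + 1" using assms(2) by (rule add_right_mono)
  finally show ?thesis by (simp add: one_enat_def)
qed

locale soltes_hypergraph =
  fixes H :: "'a hypergraph"
  assumes soltes: "soltes H"
begin

lemma hyper: "hypergraph H"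
  using soltes by (simp add: soltes_def)

lemma finite_verts: "finite (verts H)"
  using hyper by (simp add: hypergraph_def)

lemma edge_subset: "e \<in> edges H \<Longrightarrow> e \<subseteq> verts H"
  using hyper by (auto simp: hypergraph_def)

lemma finite_edge: "e \<in> edges H \<Longrightarrow> finite e"
  using edge_subset finite_verts finite_subset by blast

lemma finite_edges: "finite (edges H)"
  using hyper finite_verts by (meson finite_Pow_iff finite_subset hypergraph_def)

lemma edge_other:
  assumes "e \<in> edges H" obtains u where "u \<in> e" "u \<noteq> v"
proof -
  have "2 \<le> card e" using assms hyper by (auto simp: hypergraph_def)
  then have "\<not> e \<subseteq> {v}" using card_mono[of "{v}" e] by auto
  then show ?thesis using that by auto
qed

lemma total_split:
  assumes v: "v \<in> verts H"
  shows "total_distance H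
    = (\<Sum>p\<in>pairs (verts H - {v}). pair_dist H p) + (\<Sum>u\<in>verts H - {v}. hdist H v u)"
proof -
  have "total_distance H = (\<Sum>p\<in>pairs (verts H - {v}). pair_dist H p)
    + (\<Sum>p\<in>(\<lambda>u. {v, u}) ` (verts H - {v}). pair_dist H p)"
    unfolding total_distance_def pairs_split[OF v]
    by (rule sum.union_disjoint) (use finite_verts finite_pairs in auto)
  also have "(\<Sum>p\<in>(\<lambda>u. {v, u}) ` (verts H - {v}). pair_dist H p)
      = (\<Sum>u\<in>verts H - {v}. hdist H v u)"
    by (subst sum.reindex) (auto simp: inj_on_def doubleton_eq_iff pair_dist_eq)
  finally show ?thesis .
qed

lemma deleted_finite:
  assumes v: "v \<in> verts H" and u: "u \<in> verts H - {v}" "w \<in> verts H - {v}" "u \<noteq> w"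
  shows "hdist (delete_vertex H v) u w \<noteq> \<infinity>"
proof -
  have "(\<Sum>p\<in>pairs (verts H - {v}). pair_dist (delete_vertex H v) p) \<noteq> \<infinity>"
    using soltes v by (simp add: soltes_def total_distance_def)
  then have "pair_dist (delete_vertex H v) {u, w} \<noteq> \<infinity>"
    by (rule sum_enat_finite[rotated]) (use u finite_verts finite_pairs in auto)
  then show ?thesis by (simp add: pair_dist_eq)
qed

text \<open>Deleting \<open>v\<close> loses the distances from \<open>v\<close>, at least one for each other vertex and two for
  those without a common edge; the remaining distances have to make up for this loss.\<close>

lemma deletion_inequality:
  assumes v: "v \<in> verts H"
    and incr: "\<And>u w. \<lbrakk>u \<in> verts H - {v}; w \<in> verts H - {v}; u \<noteq> w\<rbrakk>
      \<Longrightarrow> hdist (delete_vertex H v) u w \<le> hdist H u w + enat (\<delta> {u, w})"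
  shows "card (verts H - {v}) + card {u \<in> verts H - {v}. star H v \<inter> star H u = {}}
    \<le> (\<Sum>p\<in>pairs (verts H - {v}). \<delta> p)"
proof -
  let ?V = "verts H - {v}"
  let ?A = "\<Sum>p\<in>pairs ?V. pair_dist H p"
  let ?B = "\<Sum>u\<in>?V. hdist H v u"
  have W: "total_distance H = total_distance (delete_vertex H v)" "total_distance H \<noteq> \<infinity>"
    using soltes v by (auto simp: soltes_def)
  have "?A + ?B = (\<Sum>p\<in>pairs ?V. pair_dist (delete_vertex H v) p)"
    using W(1) total_split[OF v] by (simp add: total_distance_def)
  also have "\<dots> \<le> (\<Sum>p\<in>pairs ?V. pair_dist H p + enat (\<delta> p))"
  proof (rule sum_mono)
    fix p assume "p \<in> pairs ?V"
    then obtain x y where "p = {x, y}" "x \<noteq> y" "x \<in> ?V" "y \<in> ?V" by (rule pairs_E)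
    then show "pair_dist (delete_vertex H v) p \<le> pair_dist H p + enat (\<delta> p)"
      using incr by (simp add: pair_dist_eq)
  qed
  also have "\<dots> = ?A + enat (\<Sum>p\<in>pairs ?V. \<delta> p)"
    by (simp add: sum.distrib sum_enat)
  finally have le: "?A + ?B \<le> ?A + enat (\<Sum>p\<in>pairs ?V. \<delta> p)" .
  have "?A \<noteq> \<infinity>" using W(2) total_split[OF v] by (metis plus_enat_simps(2))
  with le have B: "?B \<le> enat (\<Sum>p\<in>pairs ?V. \<delta> p)"
    by (simp add: enat_add_left_cancel_le)
  have "enat (card ?V + card {u \<in> ?V. star H v \<inter> star H u = {}})
    = (\<Sum>u\<in>?V. enat (1 + of_bool (star H v \<inter> star H u = {})))"
    by (rule sum_one_plus_of_bool[symmetric]) (simp add: finite_verts)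
  also have "\<dots> \<le> ?B"
  proof (rule sum_mono)
    fix u assume "u \<in> ?V"
    then show "enat (1 + of_bool (star H v \<inter> star H u = {})) \<le> hdist H v u"
      using hdist_ge_1[of v u H] hdist_ge_2[of v u H]
      by (auto simp: one_enat_def numeral_eq_enat eval_nat_numeral)
  qed
  also note B
  finally show ?thesis by simp
qed

lemma card_verts_ge_3: "3 \<le> card (verts H)"
proof (rule ccontr)
  assume "\<not> 3 \<le> card (verts H)"
  moreover have "2 \<le> card (verts H)" using soltes by (simp add: soltes_def)
  ultimately have "card (verts H) = 2" by simp
  then obtain u v where uv: "verts H = {u, v}" "u \<noteq> v" by (auto simp: card_2_iff)
  then have "card (verts H - {v}) \<le> 0"
    using deletion_inequality[of v "\<lambda>_. 0"] by auto
  with uv show False by simp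
qed

lemma third_vertex:
  obtains w where "w \<in> verts H" "w \<noteq> u" "w \<noteq> v"
proof -
  have "\<not> verts H \<subseteq> {u, v}"
    using card_verts_ge_3 card_mono[of "{u, v}" "verts H"] card_insert_le_m1[of 2 "{v}" u] by auto
  then show ?thesis using that by auto
qed

text \<open>If every edge through \<open>u\<close> passes through \<open>v\<close>, then \<open>u\<close> is isolated once \<open>v\<close> is deleted.\<close>

lemma star_antichain:
  assumes "u \<in> verts H" "v \<in> verts H" "star H u \<subseteq> star H v"
  shows "u = v"
proof (rule ccontr)
  assume ne: "u \<noteq> v"
  obtain w where w: "w \<in> verts H" "w \<noteq> u" "w \<noteq> v" by (rule third_vertex)
  have "hdist (delete_vertex H v) u w = \<infinity>"
    by (rule hdist_infinite[of _ "{u}"]) (use assms w in \<open>auto simp: star_def\<close>)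
  with deleted_finite[of v u w] ne w assms show False by auto
qed

lemma inj_star: "inj_on (star H) (verts H)"
  by (rule inj_onI) (simp add: star_antichain)

lemma star_subset: "star H v \<subseteq> edges H"
  by (auto simp: star_def)

lemma finite_star: "finite (star H v)"
  using finite_edges star_subset finite_subset by blast

lemma card_star_ge_2:
  assumes v: "v \<in> verts H"
  shows "2 \<le> card (star H v)"
proof (rule ccontr)
  assume "\<not> 2 \<le> card (star H v)"
  then have "card (star H v) = 0 \<or> card (star H v) = 1" by linarith
  then consider "star H v = {}" | e where "star H v = {e}"
    using finite_star by (auto simp: card_1_singleton_iff)
  then show False
  proof cases
    case 1
    obtain w where "w \<in> verts H" "w \<noteq> v" by (rule third_vertex)
    with 1 v star_antichain[of v w] show False by auto
  next
    case (2 e)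
    then have e: "e \<in> edges H" by (auto simp: star_def)
    then obtain u where "u \<in> e" "u \<noteq> v" by (rule edge_other)
    with 2 e v edge_subset[OF e] star_antichain[of v u] show False by (auto simp: star_def)
  qed
qed

text \<open>If at most one edge survives the deletion, it contains all other vertices by
  \<open>star_antichain\<close>, so no distance increases.\<close>

lemma card_costar_ge_2:
  assumes v: "v \<in> verts H"
  shows "2 \<le> card (edges H - star H v)"
proof (rule ccontr)
  assume "\<not> 2 \<le> card (edges H - star H v)"
  then have "card (edges H - star H v) = 0 \<or> card (edges H - star H v) = 1" by linarith
  then have sub: "\<exists>e. edges H - star H v \<subseteq> {e}"
    using finite_edges by (auto simp: card_1_singleton_iff)
  then obtain e where e: "edges H - star H v \<subseteq> {e}" by blast
  have mem: "u \<in> e \<and> e \<in> edges H - star H v" if "u \<in> verts H - {v}" for u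
    using that v e star_antichain[of u v] by (auto simp: star_def)
  have "hdist (delete_vertex H v) u w \<le> hdist H u w + enat 0"
    if "u \<in> verts H - {v}" "w \<in> verts H - {v}" "u \<noteq> w" for u w
  proof -
    have "hdist (delete_vertex H v) u w \<le> 1"
      by (rule hdist_le_1[where e = e]) (use that mem hyper in \<open>auto intro: hypergraph_delete\<close>)
    also have "\<dots> \<le> hdist H u w" using that by (simp add: hdist_ge_1)
    finally show ?thesis by (simp add: zero_enat_def[symmetric])
  qed
  from deletion_inequality[OF v this]
  have "verts H \<subseteq> {v}" using finite_verts by auto
  moreover obtain w where "w \<in> verts H" "w \<noteq> v" by (rule third_vertex)
  ultimately show False by auto
qed


section \<open>Vertices avoided by exactly two edges\<close>

text \<open>By \<open>star_antichain\<close>, no vertex is isolated by a deletion.\<close>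

lemma survivor:
  assumes "v \<in> verts H" "u \<in> verts H - {v}"
  obtains e where "e \<in> edges H - star H v" "u \<in> e"
  using assms star_antichain[of u v] by (auto simp: star_def)

lemma two_edges_meet:
  assumes v: "v \<in> verts H" and de: "edges H - star H v = {d, e}" "d \<noteq> e"
  shows "d \<inter> e \<noteq> {}"
proof
  assume disj: "d \<inter> e = {}"
  obtain x where x: "x \<in> d" "x \<noteq> v" using de by (metis Diff_iff edge_other insertI1)
  obtain y where y: "y \<in> e" "y \<noteq> v" using de by (metis Diff_iff edge_other insertI1 insertI2)
  have "hdist (delete_vertex H v) x y = \<infinity>"
    by (rule hdist_infinite[of _ d]) (use de disj x y in auto)
  moreover have "x \<in> verts H" "y \<in> verts H"
    using de x y edge_subset by blast+
  ultimately show False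
    using deleted_finite[OF v, of x y] x y disj by auto
qed

text \<open>After the deletion, two vertices are at distance one if they share \<open>d\<close> or \<open>e\<close> and at distance
  two otherwise. So a distance can grow only between \<open>d - e\<close> and \<open>e - d\<close>, by one, and only if some
  edge through \<open>v\<close> joined the two vertices before.\<close>

lemma two_edges_inequality:
  assumes v: "v \<in> verts H" and de: "edges H - star H v = {d, e}" "d \<noteq> e"
  shows "card (d - e) + card (e - d) + card (d \<inter> e)
    \<le> card {(x, y) \<in> (d - e) \<times> (e - d). star H x \<inter> star H y \<noteq> {}}" (is "_ \<le> card ?M")
proof -
  let ?\<Phi> = "\<lambda>p. \<exists>x\<in>d - e. \<exists>y\<in>e - d. p = {x, y} \<and> star H x \<inter> star H y \<noteq> {}"
  have E: "d \<in> edges H" "e \<in> edges H" "v \<notin> d" "v \<notin> e"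
    using de by (auto simp: star_def)
  have sub: "d \<subseteq> verts H" "e \<subseteq> verts H" using E edge_subset by auto
  have fin: "finite d" "finite e" using sub finite_verts finite_subset by blast+
  then have finM: "finite ?M" by (auto intro: finite_subset[of _ "(d - e) \<times> (e - d)"])
  have V: "verts H - {v} = d \<union> e"
  proof
    show "verts H - {v} \<subseteq> d \<union> e"
    proof
      fix u assume "u \<in> verts H - {v}"
      with v obtain f where "f \<in> edges H - star H v" "u \<in> f" by (rule survivor)
      then show "u \<in> d \<union> e" using de(1) by auto
    qed
  qed (use sub E in auto)
  obtain z where z: "z \<in> d" "z \<in> e" using two_edges_meet[OF v de] by blast
  have D: "hypergraph (delete_vertex H v)" using hyper by (rule hypergraph_delete)
  have "hdist (delete_vertex H v) u w \<le> hdist H u w + enat (if ?\<Phi> {u, w} then 1 else 0)"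
    if uw: "u \<in> verts H - {v}" "w \<in> verts H - {v}" "u \<noteq> w" for u w
  proof -
    have ge: "1 \<le> hdist H u w" using uw by (simp add: hdist_ge_1)
    consider "u \<in> d" "w \<in> d" | "u \<in> e" "w \<in> e"
      | "u \<in> d - e" "w \<in> e - d" | "u \<in> e - d" "w \<in> d - e"
      using uw V by blast
    then show ?thesis
    proof cases
      case 1
      then have "hdist (delete_vertex H v) u w \<le> 1"
        by (intro hdist_le_1[OF D, of d]) (use de in auto)
      with ge show ?thesis by (intro enat_le_add[of _ 1])
    next
      case 2
      then have "hdist (delete_vertex H v) u w \<le> 1"
        by (intro hdist_le_1[OF D, of e]) (use de in auto)
      with ge show ?thesis by (intro enat_le_add[of _ 1])
    next
      case 3
      then have le: "hdist (delete_vertex H v) u w \<le> 2"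
        by (intro hdist_le_2[OF D, of d e _ z]) (use de z in auto)
      show ?thesis
      proof (cases "star H u \<inter> star H w = {}")
        case True
        with uw have "2 \<le> hdist H u w" by (intro hdist_ge_2)
        with le show ?thesis by (rule enat_le_add)
      next
        case False
        with 3 have "?\<Phi> {u, w}" by blast
        then show ?thesis using enat_le_add_1[OF le ge] by simp
      qed
    next
      case 4
      then have le: "hdist (delete_vertex H v) u w \<le> 2"
        by (intro hdist_le_2[OF D, of e d _ z]) (use de z in auto)
      show ?thesis
      proof (cases "star H u \<inter> star H w = {}")
        case True
        with uw have "2 \<le> hdist H u w" by (intro hdist_ge_2)
        with le show ?thesis by (rule enat_le_add)
      next
        case False
        then have "{u, w} = {w, u} \<and> star H w \<inter> star H u \<noteq> {}" by auto
        with 4 have "?\<Phi> {u, w}" by blast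
        then show ?thesis using enat_le_add_1[OF le ge] by simp
      qed
    qed
  qed
  from deletion_inequality[OF v, of "\<lambda>p. if ?\<Phi> p then 1 else 0", OF this]
  have "card (verts H - {v}) \<le> (\<Sum>p\<in>pairs (verts H - {v}). if ?\<Phi> p then 1 else 0)" by simp
  also have "\<dots> = card (pairs (verts H - {v}) \<inter> {p. ?\<Phi> p})"
    using finite_verts by (simp add: sum.If_cases finite_pairs)
  also have "\<dots> \<le> card ((\<lambda>(x, y). {x, y}) ` ?M)"
  proof (rule card_mono)
    show "finite ((\<lambda>(x, y). {x, y}) ` ?M)" using finM by simp
    show "pairs (verts H - {v}) \<inter> {p. ?\<Phi> p} \<subseteq> (\<lambda>(x, y). {x, y}) ` ?M"
    proof
      fix p assume "p \<in> pairs (verts H - {v}) \<inter> {p. ?\<Phi> p}"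
      then obtain x y where "x \<in> d - e" "y \<in> e - d" "star H x \<inter> star H y \<noteq> {}" "p = {x, y}"
        by blast
      then show "p \<in> (\<lambda>(x, y). {x, y}) ` ?M" by (intro image_eqI[of _ _ "(x, y)"]) simp_all
    qed
  qed
  also have "\<dots> \<le> card ?M" by (rule card_image_le[OF finM])
  also have "card (verts H - {v}) = card (d - e) + card (e - d) + card (d \<inter> e)"
  proof -
    have "d \<union> e = (d - e) \<union> (e - d) \<union> (d \<inter> e)" by auto
    then have "card (d \<union> e) = card ((d - e) \<union> (e - d)) + card (d \<inter> e)"
      using fin by (subst (1) \<open>d \<union> e = _\<close>, intro card_Un_disjoint) auto
    also have "card ((d - e) \<union> (e - d)) = card (d - e) + card (e - d)"
      using fin by (intro card_Un_disjoint) auto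
    finally show ?thesis using V by simp
  qed
  finally show ?thesis .
qed

lemma card_star_add_costar: "card (star H v) + card (edges H - star H v) = card (edges H)"
  using card_Diff_subset[OF finite_star star_subset, of v]
    card_mono[OF finite_edges star_subset, of v] by simp

lemma doubleton_through:
  fixes X :: "'b set"
  assumes "card X = 2" "f \<in> X" "g \<notin> X" "X \<subseteq> {a, b, f, g}"
  shows "X \<in> {{f, a}, {f, b}}"
  using assms by (auto simp: card_2_iff)

text \<open>With four edges every star is a pair. Those of \<open>d - e\<close> consist of \<open>d\<close> and one of the two edges
  through \<open>v\<close>, so \<open>d - e\<close> and likewise \<open>e - d\<close> have at most two elements. For numbers up to two the
  product does not exceed the sum, which contradicts \<open>two_edges_inequality\<close>.\<close>

lemma at_least_5_edges: "5 \<le> card (edges H)"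
proof (rule ccontr)
  assume less: "\<not> 5 \<le> card (edges H)"
  have c: "card (star H u) = 2 \<and> card (edges H - star H u) = 2" if "u \<in> verts H" for u
    using card_star_ge_2[OF that] card_costar_ge_2[OF that] card_star_add_costar[of u] less by linarith
  obtain v where v: "v \<in> verts H" by (rule third_vertex)
  obtain a b where s: "star H v = {a, b}" "a \<noteq> b" using c[OF v] by (metis card_2_iff)
  obtain d e where de: "edges H - star H v = {d, e}" "d \<noteq> e" using c[OF v] by (metis card_2_iff)
  have "edges H = star H v \<union> (edges H - star H v)" using star_subset[of v] by blast
  also have "\<dots> = {a, b, d, e}" unfolding de(1) by (auto simp: s(1))
  finally have E: "edges H = {a, b, d, e}" .
  have bound: "card (f - g) \<le> 2" if fg: "{f, g} = {d, e}" for f g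
  proof -
    have ne: "f \<in> edges H" "g \<in> edges H" "edges H = {a, b, f, g}" "f \<noteq> g"
      using fg E de(2) by (auto simp: doubleton_eq_iff)
    have "star H x \<in> {{f, a}, {f, b}}" if x: "x \<in> f - g" for x
    proof -
      have "x \<in> verts H" using x ne edge_subset by blast
      then have "card (star H x) = 2" using c by blast
      moreover have "f \<in> star H x" "g \<notin> star H x" "star H x \<subseteq> {a, b, f, g}"
        using x ne star_subset by (simp_all add: star_def)
      ultimately show ?thesis by (rule doubleton_through)
    qed
    then have "star H ` (f - g) \<subseteq> {{f, a}, {f, b}}" by blast
    then have "card (star H ` (f - g)) \<le> card {{f, a}, {f, b}}" by (intro card_mono) auto
    also have "\<dots> \<le> 2" by (simp add: card_insert_if)
    also have "card (star H ` (f - g)) = card (f - g)"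
      using ne edge_subset by (intro card_image inj_on_subset[OF inj_star]) blast
    finally show ?thesis .
  qed
  have fin: "finite d" "finite e"
    using E edge_subset finite_verts by (metis finite_subset insertCI)+
  have "card {(x, y) \<in> (d - e) \<times> (e - d). star H x \<inter> star H y \<noteq> {}} \<le> card ((d - e) \<times> (e - d))"
    by (rule card_mono) (use fin in auto)
  then have "card {(x, y) \<in> (d - e) \<times> (e - d). star H x \<inter> star H y \<noteq> {}}
      \<le> card (d - e) * card (e - d)"
    by (simp add: card_cartesian_product)
  moreover have "0 < card (d \<inter> e)" using two_edges_meet[OF v de] fin by (simp add: card_gt_0_iff)
  ultimately have "card (d - e) + card (e - d) < card (d - e) * card (e - d)"
    using two_edges_inequality[OF v de] by linarith
  moreover have "card (d - e) \<in> {0, 1, 2}" "card (e - d) \<in> {0, 1, 2}"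
    using bound[of d e] bound[of e d] by (auto simp: insert_commute)
  ultimately show False by auto
qed

end

section \<open>Five edges: vertices on three of them\<close>

lemma card_sublist:
  assumes "finite L" "A \<subseteq> L"
  shows "card A = (\<Sum>X\<in>L. of_bool (X \<in> A))"
  using assms by (simp add: sum.If_cases of_bool_def Int_absorb1 Int_absorb2)

lemma card_relation_sublist:
  assumes L: "finite L" "A \<subseteq> L" "B \<subseteq> L"
  shows "card {(X, Y) \<in> A \<times> B. R X Y}
    = (\<Sum>X\<in>L. of_bool (X \<in> A) * (\<Sum>Y\<in>L. of_bool (Y \<in> B) * of_bool (R X Y)))"
proof -
  have "card {(X, Y) \<in> A \<times> B. R X Y} = (\<Sum>z\<in>L \<times> L. of_bool (z \<in> {(X, Y) \<in> A \<times> B. R X Y}))"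
    by (rule card_sublist) (use L in auto)
  also have "\<dots> = (\<Sum>X\<in>L. \<Sum>Y\<in>L. of_bool (X \<in> A) * (of_bool (Y \<in> B) * of_bool (R X Y)))"
    by (subst sum.cartesian_product) (rule sum.cong, auto)
  finally show ?thesis by (simp add: sum_distrib_left)
qed

text \<open>If \<open>P\<close> contains the singleton \<open>{a}\<close>, it is one of \<open>{a}\<close>, \<open>{a},{b}\<close>, \<open>{a},{c}\<close>, \<open>{a},{b},{c}\<close> and
  \<open>{a},{b,c}\<close>. In each case every \<open>Y \<in> Q\<close> meets so few members of \<open>P\<close> that there are at most
  \<open>|P| + |Q|\<close> intersecting pairs; this follows by linear arithmetic from \<open>q Y \<le> 1\<close> for
  the indicators \<open>q Y\<close> of \<open>Y \<in> Q\<close>.\<close>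

lemma no_singleton_link:
  assumes dist: "distinct [a, b, c]"
    and sub: "P \<subseteq> {{a}, {b}, {c}, {a, b}, {a, c}, {b, c}}" "Q \<subseteq> {{a}, {b}, {c}, {a, b}, {a, c}, {b, c}}"
    and anti: "\<And>X Y. X \<in> P \<Longrightarrow> Y \<in> P \<Longrightarrow> X \<subseteq> Y \<Longrightarrow> X = Y"
    and less: "card P + card Q < card {(X, Y) \<in> P \<times> Q. X \<inter> Y \<noteq> {}}"
  shows "{a} \<notin> P"
proof
  assume a: "{a} \<in> P"
  let ?L = "{{a}, {b}, {c}, {a, b}, {a, c}, {b, c}}"
  have ne: "a \<noteq> b" "b \<noteq> a" "a \<noteq> c" "c \<noteq> a" "b \<noteq> c" "c \<noteq> b" using dist by auto
  have antiP: "{a, b} \<notin> P" "{a, c} \<notin> P" "{b} \<in> P \<Longrightarrow> {b, c} \<notin> P" "{c} \<in> P \<Longrightarrow> {b, c} \<notin> P"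
    using a ne anti[of "{a}" "{a, b}"] anti[of "{a}" "{a, c}"] anti[of "{b}" "{b, c}"]
      anti[of "{c}" "{b, c}"] by auto
  define q where "q X = (of_bool (X \<in> Q) :: nat)" for X
  have q: "q X \<le> 1" for X by (simp add: q_def)
  have P: "card P = (\<Sum>X\<in>?L. of_bool (X \<in> P))" by (rule card_sublist[OF _ sub(1)]) simp
  have Q: "card Q = (\<Sum>Y\<in>?L. q Y)" unfolding q_def by (rule card_sublist[OF _ sub(2)]) simp
  have PQ: "card {(X, Y) \<in> P \<times> Q. X \<inter> Y \<noteq> {}}
      = (\<Sum>X\<in>?L. of_bool (X \<in> P) * (\<Sum>Y\<in>?L. q Y * of_bool (X \<inter> Y \<noteq> {})))"
    unfolding q_def by (rule card_relation_sublist[OF _ sub]) simp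
  have sumL: "(\<Sum>X\<in>?L. f X) = f {a} + f {b} + f {c} + f {a, b} + f {a, c} + f {b, c}"
    for f :: "'a set \<Rightarrow> nat"
    using ne by (simp add: doubleton_eq_iff singleton_insert_inj_eq singleton_insert_inj_eq')
  show False
    using less[unfolded P Q PQ] a antiP
      q[of "{a}"] q[of "{b}"] q[of "{c}"] q[of "{a, b}"] q[of "{a, c}"] q[of "{b, c}"]
    unfolding sumL
    by (cases "{b} \<in> P"; cases "{c} \<in> P"; cases "{b, c} \<in> P") (simp_all add: ne)
qed

lemma link_doubletons:
  assumes dist: "distinct [a, b, c]"
    and sub: "P \<subseteq> {{a}, {b}, {c}, {a, b}, {a, c}, {b, c}}" "Q \<subseteq> {{a}, {b}, {c}, {a, b}, {a, c}, {b, c}}"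
    and anti: "\<And>X Y. X \<in> P \<Longrightarrow> Y \<in> P \<Longrightarrow> X \<subseteq> Y \<Longrightarrow> X = Y"
    and less: "card P + card Q < card {(X, Y) \<in> P \<times> Q. X \<inter> Y \<noteq> {}}"
  shows "P \<subseteq> {{a, b}, {a, c}, {b, c}}"
proof -
  have ne: "a \<noteq> b" "b \<noteq> a" "a \<noteq> c" "c \<noteq> a" "b \<noteq> c" "c \<noteq> b" using dist by auto
  have "{a} \<notin> P" "{b} \<notin> P" "{c} \<notin> P"
    using no_singleton_link[of a b c P Q] no_singleton_link[of b a c P Q] no_singleton_link[of c a b P Q]
      ne sub anti less by (simp_all add: insert_commute)
  then show ?thesis using sub(1) by auto
qed

text \<open>Both orientations of each inequality are kept, for use in rewriting.\<close>

lemma distinct_5: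
  "distinct [a, b, c, d, e] \<Longrightarrow> a \<noteq> b \<and> a \<noteq> c \<and> a \<noteq> d \<and> a \<noteq> e \<and> b \<noteq> c \<and> b \<noteq> d \<and> b \<noteq> e
    \<and> c \<noteq> d \<and> c \<noteq> e \<and> d \<noteq> e \<and> b \<noteq> a \<and> c \<noteq> a \<and> d \<noteq> a \<and> e \<noteq> a \<and> c \<noteq> b \<and> d \<noteq> b
    \<and> e \<noteq> b \<and> d \<noteq> c \<and> e \<noteq> c \<and> e \<noteq> d"
  by auto

lemma subset_of_3:
  assumes "X \<subseteq> {a, b, c}" "X \<noteq> {}" "X \<noteq> {a, b, c}"
  shows "X \<in> {{a}, {b}, {c}, {a, b}, {a, c}, {b, c}}"
proof -
  have eq: "{a, b, c} \<inter> X = X" using assms(1) by (rule Int_absorb1)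
  have "{a, b, c} \<inter> X \<noteq> {}" "{a, b, c} \<inter> X \<noteq> {a, b, c}" using assms(2,3) unfolding eq .
  then have "{a, b, c} \<inter> X \<in> {{a}, {b}, {c}, {a, b}, {a, c}, {b, c}}"
    by (cases "a \<in> X"; cases "b \<in> X"; cases "c \<in> X") (simp_all add: Int_insert_left)
  then show ?thesis unfolding eq .
qed

lemma subset_of_5:
  assumes dist: "distinct [a, b, c, d, e]" and X: "X \<subseteq> {a, b, c, d, e}" "card X = 3"
  shows "X \<in> {{a, b, c}, {a, b, d}, {a, b, e}, {a, c, d}, {a, c, e}, {a, d, e},
    {b, c, d}, {b, c, e}, {b, d, e}, {c, d, e}}"
proof -
  let ?E = "{a, b, c, d, e}"
  have eq: "?E \<inter> X = X" using X(1) by (rule Int_absorb1)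
  have "card (?E \<inter> X) = 3" unfolding eq by (rule X(2))
  then have "?E \<inter> X \<in> {{a, b, c}, {a, b, d}, {a, b, e}, {a, c, d}, {a, c, e}, {a, d, e},
      {b, c, d}, {b, c, e}, {b, d, e}, {c, d, e}}"
    using distinct_5[OF dist]
    by (cases "a \<in> X"; cases "b \<in> X"; cases "c \<in> X"; cases "d \<in> X"; cases "e \<in> X")
      (simp_all add: Int_insert_left)
  then show ?thesis unfolding eq .
qed

context soltes_hypergraph
begin

definition types :: "'a set set set" where
  "types = star H ` verts H"

text \<open>The stars of the vertices on \<open>f\<close> that avoid \<open>g\<close>, without \<open>f\<close> itself.\<close>

definition links :: "'a set \<Rightarrow> 'a set \<Rightarrow> 'a set set set" where
  "links f g = {X. X \<subseteq> edges H - {f, g} \<and> insert f X \<in> types}"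

lemma types_E:
  assumes "X \<in> types" obtains u where "u \<in> verts H" "star H u = X"
  using assms by (auto simp: types_def)

lemma star_in_types: "u \<in> verts H \<Longrightarrow> star H u \<in> types"
  by (simp add: types_def)

lemma types_subset: "X \<in> types \<Longrightarrow> X \<subseteq> edges H"
  using star_subset by (auto simp: types_def)

lemma types_antichain: "X \<in> types \<Longrightarrow> Y \<in> types \<Longrightarrow> X \<subseteq> Y \<Longrightarrow> X = Y"
  using star_antichain by (auto simp: types_def)

lemma types_size:
  assumes "card (edges H) = 5" "X \<in> types"
  shows "card X = 2 \<or> card X = 3"
proof -
  obtain u where "u \<in> verts H" "star H u = X" using assms(2) by (rule types_E)
  then show ?thesis
    using assms(1) card_star_ge_2[of u] card_costar_ge_2[of u] card_star_add_costar[of u] by auto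
qed

lemma link_bij:
  assumes f: "f \<in> edges H" "g \<in> edges H" "f \<noteq> g"
  shows "bij_betw (\<lambda>x. star H x - {f}) (f - g) (links f g)"
proof (rule bij_betw_imageI)
  have f_in: "x \<in> verts H" "f \<in> star H x" "g \<notin> star H x" if "x \<in> f - g" for x
    using that f edge_subset by (auto simp: star_def)
  show "inj_on (\<lambda>x. star H x - {f}) (f - g)"
  proof (rule inj_onI)
    fix x y assume xy: "x \<in> f - g" "y \<in> f - g" "star H x - {f} = star H y - {f}"
    then have "star H x = star H y" using f_in by (metis insert_Diff)
    then show "x = y" using f_in(1) xy inj_star by (meson inj_onD)
  qed
  show "(\<lambda>x. star H x - {f}) ` (f - g) = links f g"
  proof (intro equalityI subsetI)
    fix X assume "X \<in> (\<lambda>x. star H x - {f}) ` (f - g)"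
    then obtain x where x: "x \<in> f - g" "X = star H x - {f}" by blast
    then have "insert f X = star H x" using f_in(2) by auto
    then show "X \<in> links f g"
      using x f_in[OF x(1)] star_subset by (auto simp: links_def star_in_types)
  next
    fix X assume "X \<in> links f g"
    then have X: "X \<subseteq> edges H - {f, g}" "insert f X \<in> types" by (auto simp: links_def)
    from X(2) obtain x where x: "x \<in> verts H" "star H x = insert f X" by (rule types_E)
    then have "f \<in> star H x" "g \<notin> star H x" using X f by auto
    then have "x \<in> f - g" using f by (auto simp: star_def)
    moreover have "X = star H x - {f}" using x X by auto
    ultimately show "X \<in> (\<lambda>x. star H x - {f}) ` (f - g)" by blast
  qed
qed

lemma links_antichain:
  assumes "X \<in> links f g" "Y \<in> links f g" "X \<subseteq> Y"
  shows "X = Y"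
proof -
  have "insert f X = insert f Y"
    by (rule types_antichain) (use assms in \<open>auto simp: links_def\<close>)
  then show ?thesis using assms unfolding links_def by blast
qed

lemma finite_links: "finite (links f g)"
  unfolding links_def using finite_edges by (auto intro: finite_subset[of _ "Pow (edges H)"])

text \<open>For \<open>x\<close> on \<open>d\<close> only and \<open>y\<close> on \<open>e\<close> only, the edges \<open>d\<close> and \<open>e\<close> do not count towards the
  intersection of the stars, so the stars meet exactly if the links do.\<close>

lemma links_inequality:
  assumes v: "v \<in> verts H" and de: "edges H - star H v = {d, e}" "d \<noteq> e"
  shows "card (links d e) + card (links e d) + card (d \<inter> e)
    \<le> card {(X, Y) \<in> links d e \<times> links e d. X \<inter> Y \<noteq> {}}"
proof -
  have E: "d \<in> edges H" "e \<in> edges H" using de by auto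
  let ?d = "\<lambda>x. star H x - {d}" and ?e = "\<lambda>x. star H x - {e}"
  let ?M = "{(x, y) \<in> (d - e) \<times> (e - d). star H x \<inter> star H y \<noteq> {}}"
  let ?N = "{(X, Y) \<in> links d e \<times> links e d. X \<inter> Y \<noteq> {}}"
  have d: "bij_betw ?d (d - e) (links d e)" by (rule link_bij) (use E de in auto)
  have e: "bij_betw ?e (e - d) (links e d)" by (rule link_bij) (use E de in auto)
  have "card ?M \<le> card ?N"
  proof (rule card_inj_on_le)
    show "inj_on (map_prod ?d ?e) ?M"
      using map_prod_inj_on[OF bij_betw_imp_inj_on[OF d] bij_betw_imp_inj_on[OF e]]
      by (rule inj_on_subset) auto
    show "map_prod ?d ?e ` ?M \<subseteq> ?N"
    proof
      fix z assume "z \<in> map_prod ?d ?e ` ?M"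
      then obtain x y where xy: "x \<in> d - e" "y \<in> e - d" "star H x \<inter> star H y \<noteq> {}"
        and z: "z = (?d x, ?e y)" by auto
      have "d \<notin> star H y" "e \<notin> star H x" using xy by (auto simp: star_def)
      then have "?d x \<inter> ?e y = star H x \<inter> star H y" by auto
      then show "z \<in> ?N"
        using z xy bij_betwE[OF d] bij_betwE[OF e] by simp
    qed
    show "finite ?N" using finite_links by (auto intro: finite_subset[of _ "links d e \<times> links e d"])
  qed
  then show ?thesis
    using two_edges_inequality[OF v de] bij_betw_same_card[OF d] bij_betw_same_card[OF e] by simp
qed

lemma links_small:
  assumes E: "edges H = {a, b, c, d, e}" and dist: "distinct [a, b, c, d, e]"
  shows "links d e \<subseteq> {{a}, {b}, {c}, {a, b}, {a, c}, {b, c}}"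
proof
  fix X assume X: "X \<in> links d e"
  then have t: "insert d X \<in> types" and "X \<subseteq> edges H - {d, e}" by (auto simp: links_def)
  then have sub: "X \<subseteq> {a, b, c}" using E by blast
  have size: "card (insert d X) = 2 \<or> card (insert d X) = 3"
    using types_size[OF _ t] E distinct_5[OF dist] by simp
  then have "X \<noteq> {}" by auto
  moreover have "X \<noteq> {a, b, c}"
  proof
    assume "X = {a, b, c}"
    with size distinct_5[OF dist] show False by simp
  qed
  ultimately show "X \<in> {{a}, {b}, {c}, {a, b}, {a, c}, {b, c}}" by (rule subset_of_3[OF sub])
qed

lemma links_doubletons:
  assumes E: "edges H = {a, b, c, d, e}" and dist: "distinct [a, b, c, d, e]"
    and abc: "{a, b, c} \<in> types"
  shows "links d e \<subseteq> {{a, b}, {a, c}, {b, c}}"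
    and "card (links d e) + card (links e d) + card (d \<inter> e)
      \<le> card (links d e) * card (links e d)"
    and "d \<inter> e \<noteq> {}"
proof -
  obtain v where v: "v \<in> verts H" "star H v = {a, b, c}" using abc by (rule types_E)
  then have de: "edges H - star H v = {d, e}" "d \<noteq> e"
    using E distinct_5[OF dist] by (simp_all add: insert_Diff_if)
  show meet: "d \<inter> e \<noteq> {}" using two_edges_meet[OF v(1) de] .
  have "finite d" using E finite_edge[of d] by simp
  with meet have "0 < card (d \<inter> e)" by (simp add: card_gt_0_iff)
  note ineq = links_inequality[OF v(1) de]
  show "links d e \<subseteq> {{a, b}, {a, c}, {b, c}}"
  proof (rule link_doubletons)
    show "distinct [a, b, c]" using dist by simp
    show "links d e \<subseteq> {{a}, {b}, {c}, {a, b}, {a, c}, {b, c}}" using E dist by (rule links_small)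
    show "links e d \<subseteq> {{a}, {b}, {c}, {a, b}, {a, c}, {b, c}}"
      by (rule links_small) (use E distinct_5[OF dist] in \<open>simp_all add: insert_commute\<close>)
    show "card (links d e) + card (links e d)
        < card {(X, Y) \<in> links d e \<times> links e d. X \<inter> Y \<noteq> {}}"
      using ineq \<open>0 < card (d \<inter> e)\<close> by linarith
  qed (rule links_antichain)
  have "card {(X, Y) \<in> links d e \<times> links e d. X \<inter> Y \<noteq> {}} \<le> card (links d e \<times> links e d)"
    by (rule card_mono) (auto simp: finite_links)
  with ineq show "card (links d e) + card (links e d) + card (d \<inter> e)
      \<le> card (links d e) * card (links e d)"
    by (simp add: card_cartesian_product)
qed

text \<open>Let \<open>p, q \<le> 3\<close> be the numbers of links and \<open>r = |d \<inter> e| \<ge> 1\<close>. Then \<open>p + q + r \<le> p q\<close> means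
  \<open>r + 1 \<le> (p - 1) (q - 1)\<close>: both numbers are at least two, one of them is three, and both are three
  if \<open>r \<ge> 2\<close>.\<close>

lemma triple_neighbours:
  assumes E: "edges H = {a, b, c, d, e}" and dist: "distinct [a, b, c, d, e]"
    and abc: "{a, b, c} \<in> types"
  shows "{d, a, b} \<in> types \<or> {d, a, c} \<in> types"
    and "{d, a, b} \<in> types \<and> {d, a, c} \<in> types \<and> {d, b, c} \<in> types
      \<or> {e, a, b} \<in> types \<and> {e, a, c} \<in> types \<and> {e, b, c} \<in> types"
    and "{d, e, a} \<in> types \<Longrightarrow> {d, e, b} \<in> types
      \<Longrightarrow> {d, a, b} \<in> types \<and> {d, a, c} \<in> types \<and> {d, b, c} \<in> types"
proof -
  let ?D = "{{a, b}, {a, c}, {b, c}}"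
  note P = links_doubletons[OF assms]
  have Q: "links e d \<subseteq> ?D"
    by (rule links_doubletons(1)) (use E abc distinct_5[OF dist] in \<open>simp_all add: insert_commute\<close>)
  have D: "card ?D = 3" "finite ?D" using distinct_5[OF dist] by (simp_all add: doubleton_eq_iff)
  have le: "card (links d e) \<le> 3" "card (links e d) \<le> 3"
    using card_mono[OF D(2) P(1)] card_mono[OF D(2) Q] D(1) by auto
  have full_d: "{d, a, b} \<in> types \<and> {d, a, c} \<in> types \<and> {d, b, c} \<in> types" if "card (links d e) = 3"
  proof -
    have "links d e = ?D" using card_subset_eq[OF D(2) P(1)] D(1) that by metis
    then have "{a, b} \<in> links d e" "{a, c} \<in> links d e" "{b, c} \<in> links d e" by simp_all
    then show ?thesis by (simp add: links_def)
  qed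
  have full_e: "{e, a, b} \<in> types \<and> {e, a, c} \<in> types \<and> {e, b, c} \<in> types" if "card (links e d) = 3"
  proof -
    have "links e d = ?D" using card_subset_eq[OF D(2) Q] D(1) that by metis
    then have "{a, b} \<in> links e d" "{a, c} \<in> links e d" "{b, c} \<in> links e d" by simp_all
    then show ?thesis by (simp add: links_def)
  qed
  have fin: "finite (d \<inter> e)" using E finite_edge[of d] by simp
  then have r: "1 \<le> card (d \<inter> e)" using P(3) by (simp add: Suc_le_eq card_gt_0_iff)
  define p q where "p = card (links d e)" and "q = card (links e d)"
  have ineq: "p + q + card (d \<inter> e) \<le> p * q" and le': "p \<le> 3" "q \<le> 3"
    using P(2) le by (simp_all add: p_def q_def)
  have "p \<in> {0, 1, 2, 3}" "q \<in> {0, 1, 2, 3}" using le' by auto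
  then have two: "2 \<le> p" and three: "p = 3 \<or> q = 3" and both: "2 \<le> card (d \<inter> e) \<Longrightarrow> p = 3"
    using ineq r by auto
  show "{d, a, b} \<in> types \<or> {d, a, c} \<in> types"
  proof (rule ccontr)
    assume "\<not> ?thesis"
    then have "{a, b} \<notin> links d e" "{a, c} \<notin> links d e" by (simp_all add: links_def)
    then have "links d e \<subseteq> {{b, c}}" using P(1) by blast
    then have "p \<le> 1" unfolding p_def using card_mono[of "{{b, c}}"] by fastforce
    with two show False by simp
  qed
  show "{d, a, b} \<in> types \<and> {d, a, c} \<in> types \<and> {d, b, c} \<in> types
      \<or> {e, a, b} \<in> types \<and> {e, a, c} \<in> types \<and> {e, b, c} \<in> types"
    using three full_d full_e by (auto simp: p_def q_def)
  show "{d, a, b} \<in> types \<and> {d, a, c} \<in> types \<and> {d, b, c} \<in> types"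
    if dea: "{d, e, a} \<in> types" and deb: "{d, e, b} \<in> types"
  proof -
    from dea obtain x where x: "star H x = {d, e, a}" by (rule types_E)
    from deb obtain y where y: "star H y = {d, e, b}" by (rule types_E)
    have "x \<in> d \<inter> e" "y \<in> d \<inter> e" using x y by (auto simp: star_def)
    moreover have "b \<notin> star H x" "b \<in> star H y" using x y distinct_5[OF dist] by simp_all
    then have "x \<noteq> y" by auto
    ultimately have "2 \<le> card (d \<inter> e)"
      using card_mono[OF fin, of "{x, y}"] by simp
    then show ?thesis using both full_d by (simp add: p_def)
  qed
qed

text \<open>One of \<open>{d, b, c}\<close>, \<open>{e, b, c}\<close> is a star by \<open>triple_neighbours(2)\<close>. Seen from that triple,
  \<open>triple_neighbours(1)\<close> gives \<open>{d, e, b}\<close> or \<open>{d, e, c}\<close>. Doing the same for the other two pairs in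
  \<open>{a, b, c}\<close> produces two stars through \<open>d\<close> and \<open>e\<close>, and \<open>triple_neighbours(3)\<close> applies.\<close>

lemma triple_spreads:
  assumes E: "edges H = {a, b, c, d, e}" and dist: "distinct [a, b, c, d, e]"
    and abc: "{a, b, c} \<in> types"
  shows "{a, b, d} \<in> types \<and> {a, c, d} \<in> types \<and> {b, c, d} \<in> types"
proof -
  have meet_bc: "{d, e, b} \<in> types \<or> {d, e, c} \<in> types"
    if "{d, b, c} \<in> types \<or> {e, b, c} \<in> types"
    using that triple_neighbours(1)[of d b c e a] triple_neighbours(1)[of e b c d a] E distinct_5[OF dist]
    by (simp add: insert_commute) blast
  have meet_ac: "{d, e, a} \<in> types \<or> {d, e, c} \<in> types"
    if "{d, a, c} \<in> types \<or> {e, a, c} \<in> types"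
    using that triple_neighbours(1)[of d a c e b] triple_neighbours(1)[of e a c d b] E distinct_5[OF dist]
    by (simp add: insert_commute) blast
  have meet_ab: "{d, e, a} \<in> types \<or> {d, e, b} \<in> types"
    if "{d, a, b} \<in> types \<or> {e, a, b} \<in> types"
    using that triple_neighbours(1)[of d a b e c] triple_neighbours(1)[of e a b d c] E distinct_5[OF dist]
    by (simp add: insert_commute) blast
  show ?thesis
    using triple_neighbours(2)[OF assms] meet_ab meet_ac meet_bc
      triple_neighbours(3)[of a b c d e] triple_neighbours(3)[of a c b d e]
      triple_neighbours(3)[of b c a d e] abc E distinct_5[OF dist]
    by (simp add: insert_commute) blast
qed

text \<open>Once all triples are stars, a star of size two would lie in one of them.\<close>

lemma all_triples:
  assumes E: "edges H = {a, b, c, d, e}" and dist: "distinct [a, b, c, d, e]"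
    and abc: "{a, b, c} \<in> types"
  shows "types = {X. X \<subseteq> edges H \<and> card X = 3}"
proof -
  note ne = distinct_5[OF dist]
  have 1: "{a, b, d} \<in> types \<and> {a, c, d} \<in> types \<and> {b, c, d} \<in> types"
    using assms by (rule triple_spreads)
  have 2: "{a, b, e} \<in> types \<and> {a, c, e} \<in> types \<and> {b, c, e} \<in> types"
    using triple_spreads[of a b c e d] abc E ne by (simp add: insert_commute)
  have 3: "{a, d, e} \<in> types \<and> {b, d, e} \<in> types"
    using triple_spreads[of a b d e c] 1 E ne by (simp add: insert_commute)
  have 4: "{c, d, e} \<in> types"
    using triple_spreads[of a c d e b] 1 E ne by (simp add: insert_commute)
  have triples: "X \<in> types" if X: "X \<subseteq> edges H" "card X = 3" for X
  proof -
    have "X \<in> {{a, b, c}, {a, b, d}, {a, b, e}, {a, c, d}, {a, c, e}, {a, d, e},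
        {b, c, d}, {b, c, e}, {b, d, e}, {c, d, e}}"
      using X E dist by (intro subset_of_5) simp_all
    with abc 1 2 3 4 show ?thesis by (elim insertE) simp_all
  qed
  moreover have "card X = 3" if X: "X \<in> types" for X
  proof (rule ccontr)
    have card_E: "card (edges H) = 5" using E ne by simp
    assume "card X \<noteq> 3"
    then have X2: "card X = 2" using types_size[OF card_E X] by simp
    then obtain z where z: "z \<in> edges H" "z \<notin> X"
      using card_E types_subset[OF X] by (metis numeral_eq_iff semiring_norm(88) subsetI subset_antisym)
    have "finite X" using types_subset[OF X] finite_edges finite_subset by blast
    then have "insert z X \<in> types"
      using z X2 types_subset[OF X] by (intro triples) simp_all
    then have "X = insert z X" using X by (intro types_antichain) blast+
    with z show False by blast
  qed
  ultimately show ?thesis using types_subset by blast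
qed

end

section \<open>Five edges: every vertex on two of them\<close>

lemma card_2_eq: "card X = 2 \<Longrightarrow> f \<in> X \<Longrightarrow> g \<in> X \<Longrightarrow> f \<noteq> g \<Longrightarrow> X = {f, g}"
  by (auto simp: card_2_iff)

lemma card_2_other:
  assumes "card X = 2" "f \<in> X" obtains g where "g \<in> X" "g \<noteq> f" "X = {f, g}"
proof -
  obtain x y where X: "X = {x, y}" "x \<noteq> y" using assms(1) by (metis card_2_iff)
  with assms(2) consider "f = x" | "f = y" by blast
  then show ?thesis using X that[of x] that[of y] by cases (auto simp: insert_commute)
qed

lemma enat_le_add_3:
  fixes a b :: enat
  assumes "a \<le> 3" "enat m \<le> b" "3 \<le> m + n"
  shows "a \<le> b + enat n"
proof -
  note assms(1)
  also have "(3 :: enat) \<le> enat m + enat n" using assms(3) by (simp add: numeral_eq_enat)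
  also have "\<dots> \<le> b + enat n" using assms(2) by (rule add_right_mono)
  finally show ?thesis .
qed

lemma label_5:
  assumes card_E: "card E = 5" and X: "X \<subseteq> E" "card X = 2"
  obtains a b c d e where "E = {a, b, c, d, e}" "distinct [a, b, c, d, e]" "X = {a, b}"
proof -
  have "finite E" using card_E by (metis card.infinite zero_neq_numeral)
  then have "card (E - X) = 3" using X card_E by (simp add: card_Diff_subset finite_subset)
  then obtain c d e where cde: "E - X = {c, d, e}" "c \<noteq> d" "c \<noteq> e" "d \<noteq> e" by (auto simp: card_3_iff)
  obtain a b where ab: "X = {a, b}" "a \<noteq> b" using X(2) by (metis card_2_iff)
  have "E = {a, b, c, d, e}" using X(1) cde(1) ab(1) by blast
  moreover have "distinct [a, b, c, d, e]" using cde ab by auto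
  ultimately show ?thesis using ab(1) by (rule that)
qed

lemma card_meeting_pairs:
  assumes "finite A" "finite B" "A \<inter> B = {}"
  shows "card {p \<in> pairs V. p \<inter> A \<noteq> {} \<and> p \<inter> B \<noteq> {}} \<le> card A * card B"
proof -
  have "{p \<in> pairs V. p \<inter> A \<noteq> {} \<and> p \<inter> B \<noteq> {}} \<subseteq> (\<lambda>(x, y). {x, y}) ` (A \<times> B)"
  proof
    fix p assume p: "p \<in> {p \<in> pairs V. p \<inter> A \<noteq> {} \<and> p \<inter> B \<noteq> {}}"
    then obtain x y where xy: "x \<in> p" "x \<in> A" "y \<in> p" "y \<in> B" by blast
    with assms(3) have "x \<noteq> y" by blast
    with xy p have "p = {x, y}" by (intro card_2_eq) auto
    with xy show "p \<in> (\<lambda>(x, y). {x, y}) ` (A \<times> B)" by (intro image_eqI[of _ _ "(x, y)"]) auto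
  qed
  then have "card {p \<in> pairs V. p \<inter> A \<noteq> {} \<and> p \<inter> B \<noteq> {}} \<le> card ((\<lambda>(x, y). {x, y}) ` (A \<times> B))"
    using assms by (intro card_mono) auto
  also have "\<dots> \<le> card (A \<times> B)" using assms by (intro card_image_le) auto
  finally show ?thesis by (simp add: card_cartesian_product)
qed

lemma card_pairs_subset:
  assumes "A \<subseteq> V" "finite A"
  shows "card {p \<in> pairs V. p \<subseteq> A} = card A choose 2"
proof -
  have "{p \<in> pairs V. p \<subseteq> A} = {p. p \<subseteq> A \<and> card p = 2}" using assms(1) by blast
  then show ?thesis using n_subsets[OF assms(2)] by simp
qed

context soltes_hypergraph
begin

lemma mem_star: "e \<in> edges H \<Longrightarrow> u \<in> e \<longleftrightarrow> e \<in> star H u"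
  by (simp add: star_def)

lemma card_star_image: "A \<subseteq> verts H \<Longrightarrow> card (star H ` A) = card A"
  by (rule card_image) (rule inj_on_subset[OF inj_star])

text \<open>
  Delete the vertex with star \<open>{a, b}\<close>, and let \<open>A\<close>, \<open>B\<close> and \<open>K\<close> be the sets of other vertices on
  \<open>a\<close>, on \<open>b\<close> and on neither. Distances grow only in two ways. Vertices that shared \<open>a\<close>, or
  shared \<open>b\<close>, may have to take a second edge. If there is no star \<open>{c, e}\<close>, then a vertex of \<open>A \<union> B\<close>
  on \<open>c\<close> and one on \<open>e\<close> are joined only by way of \<open>d\<close>, which costs one more. Hence
  \<open>|A| + |B| + 2 |K|\<close> is at most \<open>(|A| choose 2) + (|B| choose 2)\<close> plus, in the second case, the
  product of the numbers \<open>|C|\<close> and \<open>|F|\<close> of such vertices. As \<open>|A|, |B| \<le> 3\<close>, the binomials do not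
  exceed \<open>|A|\<close> and \<open>|B|\<close>. A star \<open>{c, e}\<close> would leave \<open>2 |K| \<ge> 6\<close> uncovered; without it
  \<open>2 |K| \<ge> 4\<close> has to be covered by \<open>|C| |F|\<close> with \<open>|C|, |F| \<le> 2\<close>, so all four possible cross stars
  occur.\<close>

lemma pair_step:
  assumes E: "edges H = {a, b, c, d, e}" and dist: "distinct [a, b, c, d, e]"
    and two: "\<And>X. X \<in> types \<Longrightarrow> card X = 2"
    and ab: "{a, b} \<in> types" and cd: "{c, d} \<in> types" and de: "{d, e} \<in> types"
  shows "{c, e} \<notin> types \<and> {a, c} \<in> types \<and> {b, c} \<in> types \<and> {a, e} \<in> types \<and> {b, e} \<in> types"
proof -
  note ne = distinct_5[OF dist]
  have edge: "a \<in> edges H" "b \<in> edges H" "c \<in> edges H" "d \<in> edges H" "e \<in> edges H"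
    using E by simp_all
  obtain v where v: "v \<in> verts H" "star H v = {a, b}" using ab by (rule types_E)
  obtain vcd where vcd: "vcd \<in> verts H" "star H vcd = {c, d}" using cd by (rule types_E)
  obtain vde where vde: "vde \<in> verts H" "star H vde = {d, e}" using de by (rule types_E)
  have star_eq: "star H u = {f, g}" if "u \<in> verts H" "f \<in> star H u" "g \<in> star H u" "f \<noteq> g" for u f g
    by (rule card_2_eq) (use that two star_in_types in auto)
  have star_E: "\<exists>g. g \<noteq> f \<and> g \<in> edges H \<and> star H u = {f, g}" if u: "u \<in> verts H" "f \<in> star H u" for u f
  proof -
    have "card (star H u) = 2" using two star_in_types u by blast
    then obtain g where "g \<in> star H u" "g \<noteq> f" "star H u = {f, g}" using u(2) by (rule card_2_other)
    moreover from this have "g \<in> edges H" using star_subset[of u] by (metis subsetD)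
    ultimately show ?thesis by (intro exI[of _ g] conjI)
  qed
  have same: "u = w" if "u \<in> verts H" "w \<in> verts H" "star H u = star H w" for u w
    using that inj_star by (meson inj_onD)
  let ?V = "verts H - {v}"
  define A B K C F where "A = a - {v}" and "B = b - {v}"
    and "K = {u \<in> ?V. star H v \<inter> star H u = {}}"
    and "C = c \<inter> (a \<union> b)" and "F = e \<inter> (a \<union> b)"
  define \<delta> where "\<delta> p = (if p \<subseteq> A then 1 else 0) + (if p \<subseteq> B then 1 else 0)
    + (if {c, e} \<in> types then 0 else if p \<inter> C \<noteq> {} \<and> p \<inter> F \<noteq> {} then 1 else (0::nat))" for p
  have fin: "finite A" "finite B" "finite K" "finite C" "finite F"
    using finite_edge edge finite_verts by (simp_all add: A_def B_def K_def C_def F_def)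
  have sub: "A \<subseteq> ?V" "B \<subseteq> ?V" "K \<subseteq> ?V" "C \<subseteq> verts H" "F \<subseteq> verts H"
    using edge_subset edge by (auto simp: A_def B_def K_def C_def F_def)
  have D: "hypergraph (delete_vertex H v)" using hyper by (rule hypergraph_delete)
  have surv: "f \<in> edges (delete_vertex H v)" if "f \<in> {c, d, e}" for f
    using that v(2) E ne by auto
  have star_V: "star H u \<noteq> {a, b}" if "u \<in> ?V" for u
    using that same[of u v] v by auto
  have hits: "\<exists>f\<in>{c, d, e}. u \<in> f" if u: "u \<in> ?V" for u
  proof -
    obtain f where "f \<in> edges H - star H v" "u \<in> f" using v(1) u by (rule survivor)
    then show ?thesis using E v(2) by auto
  qed
  have mem_AB: "u \<in> A \<longleftrightarrow> a \<in> star H u" "u \<in> B \<longleftrightarrow> b \<in> star H u" if "u \<in> ?V" for u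
    using that edge mem_star by (auto simp: A_def B_def)

  have incr: "hdist (delete_vertex H v) u w \<le> hdist H u w + enat (\<delta> {u, w})"
    if uw: "u \<in> ?V" "w \<in> ?V" "u \<noteq> w" for u w
  proof -
    have ge1: "1 \<le> hdist H u w" using uw by (simp add: hdist_ge_1)
    show ?thesis
    proof (cases "\<exists>f\<in>{c, d, e}. u \<in> f \<and> w \<in> f")
      case True
      then obtain f where "f \<in> {c, d, e}" "u \<in> f" "w \<in> f" by blast
      then have "hdist (delete_vertex H v) u w \<le> 1" using surv by (intro hdist_le_1[OF D])
      then show ?thesis using ge1 by (rule enat_le_add)
    next
      case apart: False
      have common_sub: "{u, w} \<subseteq> A \<or> {u, w} \<subseteq> B" if shared: "star H u \<inter> star H w \<noteq> {}"
      proof -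
        obtain h where h: "h \<in> star H u" "h \<in> star H w" using shared by blast
        then have "h \<in> edges H" "u \<in> h" "w \<in> h" by (auto simp: star_def)
        with apart E have "h = a \<or> h = b" by auto
        then show ?thesis
        proof
          assume "h = a"
          with h mem_AB(1) uw show ?thesis by simp
        next
          assume "h = b"
          with h mem_AB(2) uw show ?thesis by simp
        qed
      qed
      show ?thesis
      proof (cases "\<exists>f\<in>{c, d, e}. \<exists>g\<in>{c, d, e}. u \<in> f \<and> w \<in> g \<and> {f, g} \<in> types")
        case True
        then obtain f g where fg: "f \<in> {c, d, e}" "g \<in> {c, d, e}" "u \<in> f" "w \<in> g" "{f, g} \<in> types"
          by blast
        from fg(5) obtain z where z: "z \<in> verts H" "star H z = {f, g}" by (rule types_E)
        then have "z \<in> f" "z \<in> g" by (auto simp: star_def)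
        then have le: "hdist (delete_vertex H v) u w \<le> 2"
          using fg surv by (intro hdist_le_2[OF D, of f g u z])
        show ?thesis
        proof (cases "star H u \<inter> star H w = {}")
          case True
          with uw have "2 \<le> hdist H u w" by (intro hdist_ge_2)
          with le show ?thesis by (rule enat_le_add)
        next
          case False
          have "hdist (delete_vertex H v) u w \<le> hdist H u w + enat 1"
            using le ge1 by (rule enat_le_add_1)
          also have "\<dots> \<le> hdist H u w + enat (\<delta> {u, w})"
            using common_sub[OF False] by (intro add_left_mono) (auto simp: \<delta>_def)
          finally show ?thesis .
        qed
      next
        case far: False
        \<comment> \<open>As \<open>{c, d}\<close> and \<open>{d, e}\<close> are stars, one of \<open>u\<close> and \<open>w\<close> lies on \<open>c\<close> and the other on \<open>e\<close>.\<close>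
        have far': "{f, g} \<notin> types" if "f \<in> {c, d, e}" "g \<in> {c, d, e}" "u \<in> f" "w \<in> g" for f g
          using far that by blast
        from hits[OF uw(1)] obtain f where f: "f \<in> {c, d, e}" "u \<in> f" ..
        from hits[OF uw(2)] obtain g where g: "g \<in> {c, d, e}" "w \<in> g" ..
        note fg = f(1) g(1) f(2) g(2)
        have "u \<notin> d"
        proof
          assume "u \<in> d"
          with apart have "w \<notin> d" by simp
          with fg have "g = c \<or> g = e" by (metis insertE singletonD)
          with cd de have "{d, g} \<in> types" by (auto simp: insert_commute)
          with far'[of d g] fg \<open>u \<in> d\<close> show False by simp
        qed
        have "w \<notin> d"
        proof
          assume "w \<in> d"
          with fg \<open>u \<notin> d\<close> have "f = c \<or> f = e" by (metis insertE singletonD)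
          with cd de have "{f, d} \<in> types" by (auto simp: insert_commute)
          with far'[of f d] fg \<open>w \<in> d\<close> show False by simp
        qed
        have "f = c \<and> g = e \<or> f = e \<and> g = c"
          using fg apart \<open>u \<notin> d\<close> \<open>w \<notin> d\<close> by (metis insertE singletonD)
        moreover from this have nce: "{c, e} \<notin> types" using far'[OF fg] by (auto simp: insert_commute)
        moreover have cross: "x \<in> a \<union> b" if x: "x \<in> ?V" "x \<in> h" "h \<in> {c, e}" "x \<notin> d" for x h
        proof -
          have "h \<in> star H x" using x edge by (auto simp: star_def)
          moreover have "x \<in> verts H" using x(1) by simp
          ultimately obtain k where k: "k \<noteq> h" "k \<in> edges H" "star H x = {h, k}"
            using star_E[of x h] by metis
          have "star H x \<noteq> {c, e}" using nce star_in_types x(1) by (metis Diff_iff)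
          moreover have "h = c \<or> h = e" using x(3) by simp
          ultimately have "k \<noteq> c" "k \<noteq> e" using k by (metis insert_commute)+
          moreover have "k = a \<or> k = b \<or> k = c \<or> k = d \<or> k = e" using k(2) unfolding E by simp
          moreover have "x \<in> k" using k(3) by (auto simp: star_def)
          ultimately show ?thesis using x(4) by blast
        qed
        ultimately have "{u, w} \<inter> C \<noteq> {} \<and> {u, w} \<inter> F \<noteq> {}"
          using fg uw \<open>u \<notin> d\<close> \<open>w \<notin> d\<close> by (auto simp: C_def F_def)
        then have d1: "\<delta> {u, w} \<ge> 1" using nce by (simp add: \<delta>_def)
        have mid: "vcd \<in> c" "vcd \<in> d" "vde \<in> d" "vde \<in> e"
          using vcd vde by (auto simp: star_def)
        have le: "hdist (delete_vertex H v) u w \<le> 3"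
          using \<open>f = c \<and> g = e \<or> f = e \<and> g = c\<close>
        proof
          assume "f = c \<and> g = e"
          with fg mid surv show ?thesis by (intro hdist_le_3[OF D, of c d e u vcd vde w]) simp_all
        next
          assume "f = e \<and> g = c"
          with fg mid surv show ?thesis by (intro hdist_le_3[OF D, of e d c u vde vcd w]) simp_all
        qed
        show ?thesis
        proof (cases "star H u \<inter> star H w = {}")
          case True
          with uw have "enat 2 \<le> hdist H u w" using hdist_ge_2[of u w H] by (simp add: numeral_eq_enat)
          with le show ?thesis by (rule enat_le_add_3) (use d1 in simp)
        next
          case False
          have "{u, w} \<subseteq> A \<or> {u, w} \<subseteq> B" using common_sub[OF False] .
          then have "\<delta> {u, w} \<ge> 2"
            using nce \<open>{u, w} \<inter> C \<noteq> {} \<and> {u, w} \<inter> F \<noteq> {}\<close> unfolding \<delta>_def by auto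
          moreover have "enat 1 \<le> hdist H u w" using ge1 by (simp add: one_enat_def)
          ultimately show ?thesis using le by (intro enat_le_add_3[of _ 1]) simp_all
        qed
      qed
    qed
  qed
  have ineq: "card ?V + card K \<le> (\<Sum>p\<in>pairs ?V. \<delta> p)"
    using deletion_inequality[OF v(1) incr] by (simp add: K_def)
  have finV: "finite (pairs ?V)" using finite_verts by (intro finite_pairs) simp
  have "(\<Sum>p\<in>pairs ?V. \<delta> p) = card {p \<in> pairs ?V. p \<subseteq> A} + card {p \<in> pairs ?V. p \<subseteq> B}
      + (if {c, e} \<in> types then 0 else card {p \<in> pairs ?V. p \<inter> C \<noteq> {} \<and> p \<inter> F \<noteq> {}})"
    unfolding \<delta>_def sum.distrib using finV by (simp add: sum.If_cases Int_def)
  also have "\<dots> = (card A choose 2) + (card B choose 2)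
      + (if {c, e} \<in> types then 0 else card {p \<in> pairs ?V. p \<inter> C \<noteq> {} \<and> p \<inter> F \<noteq> {}})"
    using card_pairs_subset[OF sub(1) fin(1)] card_pairs_subset[OF sub(2) fin(2)] by simp
  finally have total: "(\<Sum>p\<in>pairs ?V. \<delta> p) = \<dots>" .
  have CF: "C \<inter> F = {}"
  proof (rule ccontr)
    assume "C \<inter> F \<noteq> {}"
    then obtain x where x: "x \<in> c" "x \<in> e" "x \<in> a \<or> x \<in> b" by (auto simp: C_def F_def)
    then have xs: "c \<in> star H x" "e \<in> star H x" "a \<in> star H x \<or> b \<in> star H x"
      using edge by (auto simp: star_def)
    have "x \<in> verts H" using x(1) edge_subset[OF edge(3)] by blast
    with xs ne have "star H x = {c, e}" by (intro star_eq) simp_all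
    with xs(3) ne show False by simp
  qed
  have meet: "card {p \<in> pairs ?V. p \<inter> C \<noteq> {} \<and> p \<inter> F \<noteq> {}} \<le> card C * card F"
    using fin(4,5) CF by (rule card_meeting_pairs)
  have V: "card ?V = card A + card B + card K"
  proof -
    have AB: "A \<inter> B = {}"
    proof (rule ccontr)
      assume "A \<inter> B \<noteq> {}"
      then obtain x where x: "x \<in> A" "x \<in> B" by blast
      then have xV: "x \<in> ?V" using sub(1) by blast
      then have "a \<in> star H x" "b \<in> star H x" using x mem_AB by simp_all
      with xV ne have "star H x = {a, b}" by (intro star_eq) simp_all
      with star_V \<open>x \<in> ?V\<close> show False by blast
    qed
    have KA: "K = ?V - (A \<union> B)"
      using v(2) mem_AB by (auto simp: K_def)
    then have "?V = (A \<union> B) \<union> K" using sub by blast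
    then have "card ?V = card (A \<union> B) + card K"
      using card_Un_disjoint[of "A \<union> B" K] fin KA by (metis Diff_disjoint finite_Un)
    then show ?thesis using card_Un_disjoint[OF fin(1,2) AB] by simp
  qed
  have A3: "card A \<le> 3"
  proof -
    have "star H ` A \<subseteq> {{a, c}, {a, d}, {a, e}}"
    proof
      fix X assume "X \<in> star H ` A"
      then obtain x where x: "x \<in> A" "X = star H x" by blast
      then have "x \<in> ?V" using sub(1) by blast
      then have "a \<in> star H x" using x(1) mem_AB by simp
      then obtain k where k: "k \<noteq> a" "k \<in> edges H" "star H x = {a, k}"
        using star_E[of x a] \<open>x \<in> ?V\<close> by (metis Diff_iff)
      moreover have "k \<noteq> b" using star_V[OF \<open>x \<in> ?V\<close>] k(3) by (metis insert_commute)
      ultimately have "k = c \<or> k = d \<or> k = e" unfolding E by simp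
      then show "X \<in> {{a, c}, {a, d}, {a, e}}"
        unfolding x(2) k(3) by (elim disjE) simp_all
    qed
    then have "card (star H ` A) \<le> card {{a, c}, {a, d}, {a, e}}" by (intro card_mono) simp_all
    also have "\<dots> \<le> 3" by (simp add: card_insert_if)
    finally show ?thesis using sub(1) by (subst (asm) card_star_image) auto
  qed
  have B3: "card B \<le> 3"
  proof -
    have "star H ` B \<subseteq> {{b, c}, {b, d}, {b, e}}"
    proof
      fix X assume "X \<in> star H ` B"
      then obtain x where x: "x \<in> B" "X = star H x" by blast
      then have "x \<in> ?V" using sub(2) by blast
      then have "b \<in> star H x" using x(1) mem_AB by simp
      then obtain k where k: "k \<noteq> b" "k \<in> edges H" "star H x = {b, k}"
        using star_E[of x b] \<open>x \<in> ?V\<close> by (metis Diff_iff)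
      moreover have "k \<noteq> a" using star_V[OF \<open>x \<in> ?V\<close>] k(3) by (metis insert_commute)
      ultimately have "k = c \<or> k = d \<or> k = e" unfolding E by simp
      then show "X \<in> {{b, c}, {b, d}, {b, e}}"
        unfolding x(2) k(3) by (elim disjE) simp_all
    qed
    then have "card (star H ` B) \<le> card {{b, c}, {b, d}, {b, e}}" by (intro card_mono) simp_all
    also have "\<dots> \<le> 3" by (simp add: card_insert_if)
    finally show ?thesis using sub(2) by (subst (asm) card_star_image) auto
  qed
  have cross_sub: "star H ` (f \<inter> (a \<union> b)) \<subseteq> {{a, f}, {b, f}} \<inter> types" if f: "f \<in> {c, e}" for f
  proof
    fix X assume "X \<in> star H ` (f \<inter> (a \<union> b))"
    then obtain x h where x: "X = star H x" "x \<in> f" "x \<in> h" "h \<in> {a, b}" by blast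
    have fh: "f \<in> edges H" "h \<in> edges H" "h \<noteq> f" using f x(4) ne edge by (elim insertE; simp)+
    then have xv: "x \<in> verts H" "f \<in> star H x" "h \<in> star H x" "h \<noteq> f"
      using x(2,3) edge_subset[OF fh(1)] by (auto simp: star_def)
    then have "star H x = {h, f}" by (intro star_eq)
    with x xv(1) star_in_types[of x] show "X \<in> {{a, f}, {b, f}} \<inter> types" by auto
  qed
  have cross_card: "card (f \<inter> (a \<union> b)) \<le> 2
      \<and> (card (f \<inter> (a \<union> b)) = 2 \<longrightarrow> {a, f} \<in> types \<and> {b, f} \<in> types)" if f: "f \<in> {c, e}" for f
  proof -
    have "f \<inter> (a \<union> b) \<subseteq> verts H" using f edge edge_subset by blast
    then have eq: "card (star H ` (f \<inter> (a \<union> b))) = card (f \<inter> (a \<union> b))" by (rule card_star_image)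
    have le: "card (f \<inter> (a \<union> b)) \<le> card M" if "{{a, f}, {b, f}} \<inter> types \<subseteq> M" "finite M" for M
      unfolding eq[symmetric] by (rule card_mono[OF that(2) order_trans[OF cross_sub[OF f] that(1)]])
    have "card (f \<inter> (a \<union> b)) \<le> card {{a, f}, {b, f}}" by (rule le) simp_all
    also have "\<dots> \<le> 2" by (simp add: card_insert_if)
    finally have "card (f \<inter> (a \<union> b)) \<le> 2" .
    moreover have "card (f \<inter> (a \<union> b)) \<le> 1" if "{a, f} \<notin> types"
    proof -
      have "{{a, f}, {b, f}} \<inter> types \<subseteq> {{b, f}}" using that by blast
      from le[OF this] show ?thesis by simp
    qed
    moreover have "card (f \<inter> (a \<union> b)) \<le> 1" if "{b, f} \<notin> types"
    proof -
      have "{{a, f}, {b, f}} \<inter> types \<subseteq> {{a, f}}" using that by blast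
      from le[OF this] show ?thesis by simp
    qed
    ultimately show ?thesis by (metis numeral_le_one_iff semiring_norm(69))
  qed
  have in_K: "x \<in> K" if "x \<in> verts H" "star H x \<subseteq> {c, d, e}" for x
  proof -
    have disj: "{a, b} \<inter> {c, d, e} = {}" using ne by (simp add: Int_insert_left)
    have "star H v \<inter> star H x \<subseteq> {a, b} \<inter> {c, d, e}" using that(2) unfolding v(2) by (intro Int_mono) simp_all
    then have "star H v \<inter> star H x = {}" unfolding disj by simp
    moreover from this have "x \<noteq> v" using v(2) by (metis Int_absorb insert_not_empty)
    ultimately show ?thesis using that(1) by (simp add: K_def)
  qed
  have vcd_K: "{vcd, vde} \<subseteq> K" using in_K vcd vde by simp
  have vcd_ne: "vcd \<noteq> vde" using vcd(2) vde(2) ne by (metis doubleton_eq_iff)+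
  have K2: "2 \<le> card K" using card_mono[OF fin(3) vcd_K] vcd_ne by simp
  have K3: "3 \<le> card K" if ce: "{c, e} \<in> types"
  proof -
    obtain vce where vce: "vce \<in> verts H" "star H vce = {c, e}" using ce by (rule types_E)
    then have "vce \<noteq> vcd" "vce \<noteq> vde" using vcd(2) vde(2) ne by (metis doubleton_eq_iff)+
    moreover have "{vce, vcd, vde} \<subseteq> K" using in_K vcd_K vce by simp
    ultimately show ?thesis using card_mono[OF fin(3), of "{vce, vcd, vde}"] vcd_ne by simp
  qed
  have "card A \<in> {0, 1, 2, 3}" "card B \<in> {0, 1, 2, 3}" using A3 B3 by auto
  then have AB: "(card A choose 2) \<le> card A" "(card B choose 2) \<le> card B"
    by (auto simp: choose_two)
  have nce: "{c, e} \<notin> types"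
    using K3 AB ineq total V by auto
  then have "4 \<le> card C * card F"
    using K2 AB ineq total V meet by simp
  have "card C \<in> {0, 1, 2}" "card F \<in> {0, 1, 2}"
    using cross_card[of c] cross_card[of e] by (auto simp: C_def F_def)
  then have "card C = 2" "card F = 2" using \<open>4 \<le> card C * card F\<close> by auto
  then show ?thesis using nce cross_card[of c] cross_card[of e] by (simp add: C_def F_def)
qed

text \<open>Otherwise the edge \<open>c\<close> would be cut off from \<open>d\<close> and \<open>e\<close> when the vertex with star \<open>{a, b}\<close> is
  deleted.\<close>

lemma pair_connects:
  assumes E: "edges H = {a, b, c, d, e}" and dist: "distinct [a, b, c, d, e]"
    and two: "\<And>X. X \<in> types \<Longrightarrow> card X = 2" and ab: "{a, b} \<in> types"
  shows "{c, d} \<in> types \<or> {c, e} \<in> types"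
proof (rule ccontr)
  assume no: "\<not> ?thesis"
  note ne = distinct_5[OF dist]
  obtain v where v: "v \<in> verts H" "star H v = {a, b}" using ab by (rule types_E)
  have edge: "c \<in> edges H" "d \<in> edges H" "e \<in> edges H" using E by simp_all
  have surv: "edges (delete_vertex H v) = {c, d, e}" using v(2) E ne by (simp add: insert_Diff_if)
  have "v \<notin> c" "v \<notin> d" using mem_star[OF edge(1)] mem_star[OF edge(2)] v(2) ne by simp_all
  obtain x where x: "x \<in> c" using edge_other[OF edge(1)] by blast
  obtain y where y: "y \<in> d" using edge_other[OF edge(2)] by blast
  have meet: "c \<inter> f = {}" if f: "f \<in> edges H" "f \<noteq> c" "{c, f} \<notin> types" for f
  proof (rule ccontr)
    assume "c \<inter> f \<noteq> {}"
    then obtain z where z: "z \<in> c" "z \<in> f" by blast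
    then have "z \<in> verts H" using edge_subset[OF edge(1)] by blast
    then have t: "star H z \<in> types" by (rule star_in_types)
    have "star H z = {c, f}"
      by (rule card_2_eq[OF two[OF t]]) (use z f edge in \<open>simp_all add: star_def\<close>)
    with t f(3) show False by simp
  qed
  have cd: "c \<inter> d = {}" and ce: "c \<inter> e = {}" using meet edge no ne by simp_all
  have "hdist (delete_vertex H v) x y = \<infinity>"
  proof (rule hdist_infinite[of _ c])
    fix f assume "f \<in> edges (delete_vertex H v)" "f \<inter> c \<noteq> {}"
    then show "f \<subseteq> c" unfolding surv using cd ce by (elim insertE) (simp_all add: Int_commute)
  next
    show "x \<in> c" by (rule x)
    show "y \<notin> c" using y cd by blast
  qed
  moreover have "x \<in> verts H - {v}" using x \<open>v \<notin> c\<close> edge_subset[OF edge(1)] by blast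
  moreover have "y \<in> verts H - {v}" using y \<open>v \<notin> d\<close> edge_subset[OF edge(2)] by blast
  moreover have "x \<noteq> y" using x y cd by blast
  ultimately show False using deleted_finite[OF v(1), of x y] by simp
qed

text \<open>Applied to \<open>{a, c}\<close> with the path from \<open>b\<close> over \<open>e\<close> to \<open>d\<close>, the previous step makes \<open>{a, d}\<close> a
  star; applied to \<open>{b, c}\<close> with the path from \<open>a\<close> over \<open>e\<close> to \<open>d\<close>, it forbids this.\<close>

lemma pair_path_impossible:
  assumes E: "edges H = {a, b, c, d, e}" and dist: "distinct [a, b, c, d, e]"
    and two: "\<And>X. X \<in> types \<Longrightarrow> card X = 2"
    and ab: "{a, b} \<in> types" and cd: "{c, d} \<in> types" and de: "{d, e} \<in> types"
  shows False
proof -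
  note ne = distinct_5[OF dist]
  have 1: "{c, e} \<notin> types" "{a, c} \<in> types" "{b, c} \<in> types" "{a, e} \<in> types" "{b, e} \<in> types"
    using pair_step[OF assms] by simp_all
  have "{d, a} \<in> types"
    using pair_step[of a c b e d] two E ne 1 de by (simp add: insert_commute)
  moreover have "{a, d} \<notin> types"
    using pair_step[of b c a e d] two E ne 1 de by (simp add: insert_commute)
  ultimately show False by (simp add: insert_commute)
qed

text \<open>By \<open>pair_connects\<close>, at least two of \<open>{c, d}\<close>, \<open>{c, e}\<close> and \<open>{d, e}\<close> are stars, and these form a
  path.\<close>

lemma exists_triple:
  assumes card_E: "card (edges H) = 5"
  shows "\<exists>X\<in>types. card X = 3"
proof (rule ccontr)
  assume no: "\<not> ?thesis"
  then have two: "card X = 2" if "X \<in> types" for X using types_size[OF card_E that] that by metis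
  obtain v where v: "v \<in> verts H" by (rule third_vertex)
  then have star2: "card (star H v) = 2" by (intro two star_in_types)
  obtain a b c d e where E: "edges H = {a, b, c, d, e}" and dist: "distinct [a, b, c, d, e]"
    and "star H v = {a, b}"
    using label_5[OF card_E star_subset star2] by metis
  then have ab: "{a, b} \<in> types" using star_in_types[OF v] by simp
  note ne = distinct_5[OF dist]
  have "{c, d} \<in> types \<or> {c, e} \<in> types"
    using pair_connects[of a b c d e] two ab E ne by simp
  moreover have "{c, d} \<in> types \<or> {d, e} \<in> types"
    using pair_connects[of a b d c e] two ab E ne by (simp add: insert_commute)
  moreover have "{c, e} \<in> types \<or> {d, e} \<in> types"
    using pair_connects[of a b e c d] two ab E ne by (simp add: insert_commute)
  moreover have "\<not> ({c, d} \<in> types \<and> {d, e} \<in> types)"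
    using pair_path_impossible[of a b c d e] two ab E dist by metis
  moreover have "\<not> ({c, e} \<in> types \<and> {d, e} \<in> types)"
    using pair_path_impossible[of a b c e d] two ab E ne by (simp add: insert_commute) blast
  moreover have "\<not> ({c, d} \<in> types \<and> {c, e} \<in> types)"
    using pair_path_impossible[of a b d c e] two ab E ne by (simp add: insert_commute) blast
  ultimately show False by blast
qed

lemma types_are_triples:
  assumes card_E: "card (edges H) = 5"
  shows "types = {X. X \<subseteq> edges H \<and> card X = 3}"
proof -
  obtain X where X: "X \<in> types" "card X = 3" using exists_triple[OF card_E] by blast
  note sub = types_subset[OF X(1)]
  have "card (edges H - X) = 2"
    using X(2) card_E sub finite_edges by (simp add: card_Diff_subset finite_subset)
  then obtain d e a b c where E: "edges H = {d, e, a, b, c}" and dist: "distinct [d, e, a, b, c]"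
    and de: "edges H - X = {d, e}"
    using label_5[OF card_E Diff_subset] by metis
  have "X = edges H - {d, e}" unfolding de[symmetric] using sub by blast
  also have "\<dots> = {a, b, c}" using E distinct_5[OF dist] by (simp add: insert_Diff_if)
  finally have "{a, b, c} \<in> types" using X(1) by simp
  then show ?thesis
    using E distinct_5[OF dist] by (intro all_triples[of a b c d e]) (simp_all add: insert_commute)
qed

end

section \<open>The dual of the complete 3-uniform hypergraph on five points\<close>

abbreviation triples :: "nat set set" where
  "triples \<equiv> {T. T \<subseteq> {1..5} \<and> card T = 3}"

abbreviation dual_K :: "nat set hypergraph" where
  "dual_K \<equiv> dual (complete_hypergraph 5 3)"

lemma verts_dual_K: "verts dual_K = triples"
  by (simp add: dual_def complete_hypergraph_def)

lemma edges_dual_K: "edges dual_K = (\<lambda>x. {T \<in> triples. x \<in> T}) ` {1..5}"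
  by (simp add: dual_def complete_hypergraph_def)

lemma card_subsets_through:
  assumes "finite A" "x \<notin> A"
  shows "card {T. T \<subseteq> insert x A \<and> card T = Suc k \<and> x \<in> T} = card A choose k"
proof -
  have "{T. T \<subseteq> insert x A \<and> card T = Suc k \<and> x \<in> T} = insert x ` {S. S \<subseteq> A \<and> card S = k}"
  proof (intro equalityI subsetI)
    fix T assume T: "T \<in> {T. T \<subseteq> insert x A \<and> card T = Suc k \<and> x \<in> T}"
    then have "finite T" using assms finite_subset by blast
    then have "T - {x} \<in> {S. S \<subseteq> A \<and> card S = k}" "T = insert x (T - {x})" using T by auto
    then show "T \<in> insert x ` {S. S \<subseteq> A \<and> card S = k}" by blast
  next
    fix T assume "T \<in> insert x ` {S. S \<subseteq> A \<and> card S = k}"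
    then obtain S where "S \<subseteq> A" "card S = k" "T = insert x S" by blast
    moreover from this have "finite S" "x \<notin> S" using assms finite_subset by blast+
    ultimately show "T \<in> {T. T \<subseteq> insert x A \<and> card T = Suc k \<and> x \<in> T}" by auto
  qed
  moreover have "inj_on (insert x) {S. S \<subseteq> A \<and> card S = k}"
    using assms(2) by (auto simp: inj_on_def dest: insert_ident[THEN iffD1, rotated 2])
  ultimately show ?thesis using n_subsets[OF assms(1)] by (simp add: card_image)
qed

lemma inj_dual_edge: "inj_on (\<lambda>x. {T \<in> triples. x \<in> T}) {1..5}"
proof (rule inj_onI, rule ccontr)
  fix x y :: nat
  assume xy: "x \<in> {1..5}" "y \<in> {1..5}" "x \<noteq> y"
    and eq: "{T \<in> triples. x \<in> T} = {T \<in> triples. y \<in> T}"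
  have "card ({1..5} - {x, y}) = 3" using xy by (subst card_Diff_subset) auto
  then have "2 \<le> card ({1..5} - {x, y})" by simp
  then obtain S where S: "S \<subseteq> {1..5} - {x, y}" "card S = 2" "finite S"
    by (rule obtain_subset_with_card_n)
  then have "card (insert x S) = 3" by (subst card_insert_disjoint) auto
  then have "insert x S \<in> {T \<in> triples. x \<in> T}" using S xy by auto
  then have "insert x S \<in> {T \<in> triples. y \<in> T}" unfolding eq .
  then have "y \<in> insert x S" by simp
  then show False using S(1) xy(3) by blast
qed

lemma hsize_dual_K: "hsize dual_K = 5"
  unfolding hsize_def edges_dual_K by (subst card_image[OF inj_dual_edge]) simp

lemma finite_triples: "finite triples"
  by (rule finite_subset[of _ "Pow {1..5}"]) auto

lemma finite_triple: "T \<in> triples \<Longrightarrow> finite T"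
  by (rule finite_subset[of _ "{1..5}"]) simp_all

lemma card_triples: "card triples = 10"
  by (subst n_subsets) (simp_all add: choose_reduce_nat)

lemma hypergraph_dual_K: "hypergraph dual_K"
  unfolding hypergraph_def verts_dual_K edges_dual_K
proof (intro conjI ballI)
  show "finite triples" by (rule finite_triples)
  show "(\<lambda>x. {T \<in> triples. x \<in> T}) ` {1..5} \<subseteq> Pow triples" by blast
  fix e assume "e \<in> (\<lambda>x. {T \<in> triples. x \<in> T}) ` {1..5}"
  then obtain x where x: "x \<in> {1..5}" "e = {T \<in> triples. x \<in> T}" by blast
  then have "insert x ({1..5} - {x}) = {1..5}" by auto
  then have "e = {T. T \<subseteq> insert x ({1..5} - {x}) \<and> card T = Suc 2 \<and> x \<in> T}"
    using x(2) by auto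
  then have "card e = card ({1..5} - {x}) choose 2"
    using card_subsets_through[of "{1..5} - {x}" x 2] by simp
  then show "2 \<le> card e" using x(1) by (simp add: choose_two)
qed

lemma triples_meet:
  assumes "S \<in> triples" "T \<in> triples"
  shows "S \<inter> T \<noteq> {}"
proof
  assume disj: "S \<inter> T = {}"
  have fin: "finite S" "finite T" by (rule finite_triple, rule assms)+
  have "card (S \<union> T) \<le> card {1..5::nat}" using assms by (intro card_mono) auto
  then show False using assms card_Un_disjoint[OF fin disj] by simp
qed

lemma hdist_dual_K_le:
  assumes "S \<in> triples" "T \<in> triples"
  shows "hdist dual_K S T \<le> 1"
proof -
  obtain x where x: "x \<in> S" "x \<in> T" using triples_meet[OF assms] by blast
  show ?thesis
    by (rule hdist_le_1[OF hypergraph_dual_K, of "{T \<in> triples. x \<in> T}"])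
      (use x assms edges_dual_K in auto)
qed

lemma total_distance_dual_K: "total_distance dual_K = 45"
proof -
  have "total_distance dual_K = (\<Sum>p\<in>pairs triples. enat 1)"
    unfolding total_distance_def verts_dual_K
  proof (rule sum.cong[OF refl])
    fix p assume "p \<in> pairs triples"
    then obtain S T where "p = {S, T}" "S \<noteq> T" "S \<in> triples" "T \<in> triples" by (rule pairs_E)
    then show "pair_dist dual_K p = enat 1"
      using hdist_dual_K_le[of S T] hdist_ge_1[of S T dual_K]
      by (simp add: pair_dist_eq one_enat_def)
  qed
  also have "\<dots> = enat (card (pairs triples))" by (simp only: sum_enat card_eq_sum)
  also have "card (pairs triples) = card triples choose 2" using n_subsets[OF finite_triples] .
  also have "\<dots> = 45" unfolding card_triples by (simp add: choose_two)
  finally show ?thesis by (simp add: numeral_eq_enat)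
qed

text \<open>Deleting the triple \<open>S\<close> leaves the two edges of the points \<open>d\<close> and \<open>e\<close> outside \<open>S\<close>. The only
  distances that increase, from one to two, are those between the three triples that contain \<open>d\<close>
  but not \<open>e\<close> and the three that contain \<open>e\<close> but not \<open>d\<close>. These nine units replace the nine
  distances from \<open>S\<close>.\<close>

lemma total_distance_delete_dual_K:
  assumes S: "S \<in> triples"
  shows "total_distance (delete_vertex dual_K S) = 45"
proof -
  let ?D = "delete_vertex dual_K S"
  let ?V = "triples - {S}"
  let ?st = "\<lambda>x. {T \<in> triples. x \<in> T}"
  have "finite S" using S by (rule finite_triple)
  then have "card ({1..5} - S) = 2" using S by (simp add: card_Diff_subset)
  then obtain d e where de: "{1..5} - S = {d, e}" "d \<noteq> e" by (auto simp: card_2_iff)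
  then have mem: "d \<in> {1..5}" "e \<in> {1..5}" "d \<notin> S" "e \<notin> S" by blast+
  have V: "verts ?D = ?V" by (simp add: verts_dual_K)
  have "edges ?D = {f \<in> edges dual_K. S \<notin> f}" by (auto simp: star_def)
  also have "\<dots> = ?st ` {x \<in> {1..5}. S \<notin> ?st x}" unfolding edges_dual_K by blast
  also have "{x \<in> {1..5}. S \<notin> ?st x} = {d, e}" using S de(1) by blast
  finally have edges: "edges ?D = {?st d, ?st e}" by simp
  have ed: "?st d \<in> edges ?D" "?st e \<in> edges ?D" unfolding edges by simp_all
  have D: "hypergraph ?D" using hypergraph_dual_K by (rule hypergraph_delete)
  have hit: "d \<in> T \<or> e \<in> T" if T: "T \<in> ?V" for T
  proof (rule ccontr)
    assume "\<not> ?thesis"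
    moreover have "T - S \<subseteq> {d, e}" unfolding de(1)[symmetric] using T by (intro Diff_mono) simp_all
    ultimately have "T \<subseteq> S" by blast
    then have "T = S" using card_subset_eq[OF \<open>finite S\<close> \<open>T \<subseteq> S\<close>] S T by simp
    with T show False by simp
  qed
  define P Q where "P = {T \<in> triples. d \<in> T \<and> e \<notin> T}" and "Q = {T \<in> triples. e \<in> T \<and> d \<notin> T}"
  have card_through: "card {T \<in> triples. x \<in> T \<and> y \<notin> T} = 3"
    if xy: "x \<in> {1..5}" "y \<in> {1..5}" "x \<noteq> y" for x y
  proof -
    have "insert x ({1..5} - {x, y}) = {1..5} - {y}" using xy by auto
    then have "{T \<in> triples. x \<in> T \<and> y \<notin> T}
        = {T. T \<subseteq> insert x ({1..5} - {x, y}) \<and> card T = Suc 2 \<and> x \<in> T}" by auto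
    moreover have "card ({1..5} - {x, y}) = 3" using xy by (subst card_Diff_subset) auto
    ultimately show ?thesis
      using card_subsets_through[of "{1..5} - {x, y}" x 2] by (simp add: choose_two)
  qed
  have PQ: "card P = 3" "card Q = 3" "P \<inter> Q = {}" "P \<subseteq> ?V" "Q \<subseteq> ?V"
    using card_through mem de(2) S by (auto simp: P_def Q_def)
  let ?\<Phi> = "\<lambda>p. p \<inter> P \<noteq> {} \<and> p \<inter> Q \<noteq> {}"
  have "\<exists>z\<in>triples. d \<in> z \<and> e \<in> z"
  proof -
    have "S \<noteq> {}" and S5: "S \<subseteq> {1..5}" using S by auto
    then obtain s where s: "s \<in> S" by (metis all_not_in_conv)
    then have "s \<noteq> d \<and> s \<noteq> e" using mem(3,4) by metis
    moreover have "s \<in> {1..5}" using S5 s by (rule subsetD)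
    ultimately have "{s, d, e} \<in> triples" using mem(1,2) de(2) by simp
    then show ?thesis by (rule bexI[rotated]) simp
  qed
  then obtain z where z: "z \<in> triples" "d \<in> z" "e \<in> z" by blast
  have dist: "hdist ?D T U = enat (1 + of_bool (?\<Phi> {T, U}))"
    if TU: "T \<in> ?V" "U \<in> ?V" "T \<noteq> U" for T U
  proof (cases "?\<Phi> {T, U}")
    case False
    then have "(d \<in> T \<and> d \<in> U) \<or> (e \<in> T \<and> e \<in> U)"
      using hit[OF TU(1)] hit[OF TU(2)] TU by (auto simp: P_def Q_def)
    then have "hdist ?D T U \<le> 1"
    proof
      assume "d \<in> T \<and> d \<in> U"
      then show ?thesis using TU by (intro hdist_le_1[OF D ed(1)]) simp_all
    next
      assume "e \<in> T \<and> e \<in> U"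
      then show ?thesis using TU by (intro hdist_le_1[OF D ed(2)]) simp_all
    qed
    then have "hdist ?D T U = 1" using hdist_ge_1[OF TU(3)] by (rule antisym)
    moreover have "of_bool (?\<Phi> {T, U}) = (0 :: nat)" using False by (rule of_bool_eq_0_iff[THEN iffD2])
    ultimately show ?thesis by (simp only: one_enat_def add_0_right)
  next
    case True
    then have cross: "T \<in> P \<and> U \<in> Q \<or> T \<in> Q \<and> U \<in> P" using PQ(3) by blast
    then have "star ?D T \<inter> star ?D U = {}"
      unfolding star_def edges by (auto simp: P_def Q_def)
    then have "2 \<le> hdist ?D T U" using TU(3) by (rule hdist_ge_2[rotated])
    moreover have "hdist ?D T U \<le> 2"
      using cross
    proof
      assume "T \<in> P \<and> U \<in> Q"
      then show ?thesis
        using z by (intro hdist_le_2[OF D ed, of T z U]) (simp_all add: P_def Q_def)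
    next
      assume "T \<in> Q \<and> U \<in> P"
      then show ?thesis
        using z by (intro hdist_le_2[OF D ed(2,1), of T z U]) (simp_all add: P_def Q_def)
    qed
    ultimately have "hdist ?D T U = 2" by (intro antisym)
    moreover have "of_bool (?\<Phi> {T, U}) = (1 :: nat)" using True by (rule of_bool_eq_1_iff[THEN iffD2])
    ultimately show ?thesis by (simp only: numeral_eq_enat one_add_one)
  qed
  have finV: "finite ?V" using finite_triples by simp
  have "total_distance ?D = (\<Sum>p\<in>pairs ?V. enat (1 + of_bool (?\<Phi> p)))"
    unfolding total_distance_def V
  proof (rule sum.cong[OF refl])
    fix p assume "p \<in> pairs ?V"
    then obtain T U where "p = {T, U}" "T \<noteq> U" "T \<in> ?V" "U \<in> ?V" by (rule pairs_E)
    then show "pair_dist ?D p = enat (1 + of_bool (?\<Phi> p))" using dist by (simp add: pair_dist_eq)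
  qed
  also have "\<dots> = enat (card (pairs ?V) + card {p \<in> pairs ?V. ?\<Phi> p})"
    using finite_pairs[OF finV] by (rule sum_one_plus_of_bool)
  also have "card (pairs ?V) = 36"
    unfolding n_subsets[OF finV] card_Diff_singleton[OF S] card_triples by (simp add: choose_two)
  also have "card {p \<in> pairs ?V. ?\<Phi> p} = 9"
  proof -
    have "bij_betw (\<lambda>(T, U). {T, U}) (P \<times> Q) {p \<in> pairs ?V. ?\<Phi> p}"
    proof (rule bij_betw_imageI)
      show "inj_on (\<lambda>(T, U). {T, U}) (P \<times> Q)"
        using PQ(3) by (auto simp: inj_on_def doubleton_eq_iff)
      show "(\<lambda>(T, U). {T, U}) ` (P \<times> Q) = {p \<in> pairs ?V. ?\<Phi> p}"
      proof (intro equalityI subsetI)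
        fix p assume "p \<in> (\<lambda>(T, U). {T, U}) ` (P \<times> Q)"
        then obtain T U where TU: "T \<in> P" "U \<in> Q" "p = {T, U}" by blast
        then have "T \<noteq> U" using PQ(3) by blast
        then have "card p = 2" using TU(3) by simp
        with TU PQ(4,5) show "p \<in> {p \<in> pairs ?V. ?\<Phi> p}" by blast
      next
        fix p assume p: "p \<in> {p \<in> pairs ?V. ?\<Phi> p}"
        then obtain T U where TU: "T \<in> p" "T \<in> P" "U \<in> p" "U \<in> Q" by blast
        then have "T \<noteq> U" using PQ(3) by blast
        then have "p = {T, U}" using TU p by (intro card_2_eq) simp_all
        then show "p \<in> (\<lambda>(T, U). {T, U}) ` (P \<times> Q)" using TU by (intro image_eqI[of _ _ "(T, U)"]) simp_all
      qed
    qed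
    then show ?thesis using PQ(1,2) by (simp add: bij_betw_same_card[symmetric] card_cartesian_product)
  qed
  finally show ?thesis by (simp add: numeral_eq_enat)
qed

lemma soltes_dual_K: "soltes dual_K"
  unfolding soltes_def
proof (intro conjI ballI)
  show "hypergraph dual_K" by (rule hypergraph_dual_K)
  show "2 \<le> card (verts dual_K)" unfolding verts_dual_K card_triples by simp
  show "hconnected dual_K"
    unfolding hconnected_def verts_dual_K
  proof (intro ballI)
    fix S T assume "S \<in> triples" "T \<in> triples"
    then show "hdist dual_K S T \<noteq> \<infinity>" using hdist_dual_K_le[of S T] by (metis enat_ord_code(5) one_enat_def enat.distinct(1))
  qed
  fix S assume "S \<in> verts dual_K"
  then have "total_distance (delete_vertex dual_K S) = 45"
    unfolding verts_dual_K by (rule total_distance_delete_dual_K)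
  then show "total_distance (delete_vertex dual_K S) \<noteq> \<infinity>"
    "total_distance dual_K = total_distance (delete_vertex dual_K S)"
    by (simp_all add: total_distance_dual_K)
qed

context soltes_hypergraph
begin

text \<open>Number the edges by \<open>1, \<dots>, 5\<close> and send each vertex to the numbers of its star.\<close>

lemma isomorphic_dual_K:
  assumes card_E: "card (edges H) = 5"
    and types_eq: "types = {X. X \<subseteq> edges H \<and> card X = 3}"
  shows "hisomorphic H dual_K"
proof -
  obtain g where g: "bij_betw g (edges H) {1..5::nat}"
    using finite_same_card_bij[OF finite_edges, of "{1..5::nat}"] card_E by auto
  then have inj_g: "inj_on g (edges H)" and im_g: "g ` edges H = {1..5}"
    by (auto simp: bij_betw_def)
  define f where "f v = g ` star H v" for v
  have inj_f: "inj_on f (verts H)"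
  proof (rule inj_onI)
    fix u v assume uv: "u \<in> verts H" "v \<in> verts H" "f u = f v"
    then have "star H u = star H v"
      unfolding f_def using inj_on_image_eq_iff[OF inj_g star_subset star_subset] by blast
    with uv inj_star show "u = v" by (meson inj_onD)
  qed
  have "f ` verts H = (`) g ` types" by (auto simp: f_def types_def)
  also have "\<dots> = triples"
  proof (intro equalityI subsetI)
    fix T assume "T \<in> (`) g ` types"
    then obtain X where X: "X \<subseteq> edges H" "card X = 3" "T = g ` X" using types_eq by blast
    then have "card T = 3" using card_image[OF inj_on_subset[OF inj_g X(1)]] by simp
    then show "T \<in> triples" using X(1,3) im_g by blast
  next
    fix T assume T: "T \<in> triples"
    then obtain X where X: "X \<subseteq> edges H" "T = g ` X" using im_g by (metis (lifting) mem_Collect_eq subset_image_iff)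
    then have "card X = 3" using T card_image[OF inj_on_subset[OF inj_g X(1)]] by simp
    then show "T \<in> (`) g ` types" using X types_eq by blast
  qed
  finally have im_f: "f ` verts H = triples" .
  have edge: "f ` e = {T \<in> triples. g e \<in> T}" if e: "e \<in> edges H" for e
  proof -
    have "g e \<in> f v \<longleftrightarrow> v \<in> e" if "v \<in> verts H" for v
      using inj_on_image_mem_iff[OF inj_g e star_subset, of v] e by (simp add: f_def star_def)
    then have "e = {v \<in> verts H. g e \<in> f v}" using edge_subset[OF e] by blast
    then have "f ` e = f ` {v \<in> verts H. g e \<in> f v}" by simp
    also have "\<dots> = {T \<in> f ` verts H. g e \<in> T}" by blast
    finally show ?thesis by (simp only: im_f)
  qed
  have "(\<lambda>e. f ` e) ` edges H = (\<lambda>e. {T \<in> triples. g e \<in> T}) ` edges H"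
    by (rule image_cong[OF refl edge])
  also have "\<dots> = (\<lambda>x. {T \<in> triples. x \<in> T}) ` g ` edges H" by (simp only: image_image)
  also have "\<dots> = edges dual_K" unfolding im_g edges_dual_K ..
  finally show ?thesis
    using inj_f im_f unfolding hisomorphic_def bij_betw_def verts_dual_K by blast
qed

end

theorem mainTheorem5:
  "soltes (dual (complete_hypergraph 5 3)) \<and>
   (\<forall>H :: 'a hypergraph. soltes H \<longrightarrow> hsize (dual (complete_hypergraph 5 3)) \<le> hsize H) \<and>
   (\<forall>H :: 'a hypergraph. soltes H \<and> hsize H = hsize (dual (complete_hypergraph 5 3))
      \<longrightarrow> hisomorphic H (dual (complete_hypergraph 5 3)))"
proof (intro conjI allI impI)
  show "soltes dual_K" by (rule soltes_dual_K)
  fix H :: "'a hypergraph"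
  show "hsize dual_K \<le> hsize H" if "soltes H"
  proof -
    interpret soltes_hypergraph H using that by unfold_locales
    show ?thesis using at_least_5_edges by (simp only: hsize_dual_K) (simp only: hsize_def)
  qed
  show "hisomorphic H dual_K" if "soltes H \<and> hsize H = hsize dual_K"
  proof -
    interpret soltes_hypergraph H using that by unfold_locales simp
    have "card (edges H) = 5" using that by (simp only: hsize_dual_K) (simp only: hsize_def)
    then show ?thesis using types_are_triples by (intro isomorphic_dual_K)
  qed
qed

end
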